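(* Consider $N$ mobile robots $i\in\{1,\dots,N\}$ with headings $\theta_i(t)\in\mathbb{S}^1=[0,2\pi)$, communicating over a (strongly) connected topology and running the rate-constrained pulse-coupled heading control described in the context with the phase response function $F(\phi)=\alpha Q(\phi)$, where $\alpha\in(0,1]$ and $$Q(\phi)=\begin{cases}-\phi & 0\le \phi\le \pi,\\ 2\pi-\phi & \pi<\phi<2\pi,\end{cases}$$ together with a refractory period $D\in[0,2\pi)$. Suppose the initial headings lie in a containing arc of length less than some $\bar\Lambda\in(0,\pi]$, and that $D\le 2\pi-\bar\Lambda$. Then the headings of all robots synchronize, i.e. the length $\Lambda$ of the containing arc of the headings converges to $0$, while the heading rate constraint $|\dot\theta_i|\le\omega_{\max}$ is satisfied at all times.
   Context: Rate-constrained pulse-coupled heading control: each robot $i$ has a heading $\theta_i\in[0,2\pi)$ and an auxiliary phase variable $\phi_i\in[0,2\pi)$ with $\phi_i(0)=\theta_i(0)$. Fix a fundamental frequency $\omega_0>0$ and a maximum rotation rate $\omega_{\max}>0$. The phase evolves as $\dot\phi_i=\omega_i$, where normally $\omega_i=\omega_0$. When $\phi_i$ reaches $2\pi$, robot $i$ fires a pulse, received instantly by all its neighbors, and $\phi_i$ is reset to $0$. When robot $i$ receives a pulse (and, if a refractory period $D$ is used, its phase is not in $[0,D)$; pulses received while $\phi_i\in[0,D)$ are ignored), it computes the desired adjustment $\psi_i=F(\phi_i)$ from its current phase, sets $\omega_i=\omega_0+\omega_{\max}$ if $\psi_i>0$ or $\omega_i=\omega_0-\omega_{\max}$ if $\psi_i<0$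 (and $\omega_i=\omega_0$ if $\psi_i=0$), keeps this rate for duration $\tau_i=|\psi_i|/\omega_{\max}$, and then returns to $\omega_i=\omega_0$; if a new pulse is received before $\tau_i$ has elapsed, the adjustment is recomputed from the current phase, replacing the old one. The heading is driven by $\dot\theta_i=\dot\phi_i-\omega_0$, so $|\dot\theta_i|\le\omega_{\max}$ and $\theta_i=(\phi_i-\omega_0 t)\bmod 2\pi$. An arc is a connected subset of the circle $[0,2\pi)$; the containing arc of a set of points on the circle is the smallest arc containing them all. If the values are sorted $x_1\le\dots\le x_N$ and $v_{i,i+1}=x_{i+1}-x_i$ for $i<N$, $v_{N,1}=2\pi-(x_N-x_1)$, its length is $\Lambda=2\pi-\max_i v_{i,i+1}$. *)

theory Defs
  imports Complex_Main
begin

definition wrap :: "real \<Rightarrow> real" where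
  "wrap x = x - 2 * pi * of_int \<lfloor>x / (2 * pi)\<rfloor>"

definition Q :: "real \<Rightarrow> real" where
  "Q \<phi> = (if \<phi> \<le> pi then - \<phi> else 2 * pi - \<phi>)"

definition arc_len :: "nat \<Rightarrow> (nat \<Rightarrow> real) \<Rightarrow> real" where
  "arc_len N x =
     (let xs = sort (map x [0..<N]);
          gaps = map (\<lambda>k. xs ! (k + 1) - xs ! k) [0..<N - 1]
                 @ [2 * pi - (last xs - hd xs)]
      in 2 * pi - Max (set gaps))"

text \<open>Strong connectivity of the directed graph E on the nodes 0..N-1
  (E j i: robot i receives the pulses of robot j).\<close>
definition strongly_connected :: "nat \<Rightarrow> (nat \<Rightarrow> nat \<Rightarrow> bool) \<Rightarrow> bool" where
  "strongly_connected N E \<longleftrightarrow>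
     (\<forall>i<N. \<forall>j<N. (\<lambda>a b. a < N \<and> b < N \<and> E a b)\<^sup>*\<^sup>* i j)"

text \<open>The executions are described through the unwrapped phase p i t (a continuous
  function with p i 0 = theta_i(0)); the actual phase is phi_i(t) = wrap (p i t),
  so the reset 2 pi to 0 is built in, and the heading is wrap (p i t - omega0 t).
  Robot j fires at time s > 0 when its phase reaches 2 pi, i.e. p j s is a
  multiple of 2 pi approached from below.\<close>
definition fires :: "(nat \<Rightarrow> real \<Rightarrow> real) \<Rightarrow> nat \<Rightarrow> real \<Rightarrow> bool" where
  "fires p j s \<longleftrightarrow> s > 0 \<and> (\<exists>k::int. p j s = 2 * pi * of_int k) \<and>
     (\<exists>\<epsilon>>0. \<forall>u. s - \<epsilon> < u \<and> u < s \<longrightarrow> p j u < p j s)"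

definition accepted ::
  "nat \<Rightarrow> (nat \<Rightarrow> nat \<Rightarrow> bool) \<Rightarrow> real \<Rightarrow> (nat \<Rightarrow> real \<Rightarrow> real) \<Rightarrow> nat \<Rightarrow> real set" where
  "accepted N E D p i =
     {s. (\<exists>j<N. E j i \<and> fires p j s) \<and> \<not> (wrap (p i s) < D)}"

definition adj :: "real \<Rightarrow> (nat \<Rightarrow> real \<Rightarrow> real) \<Rightarrow> nat \<Rightarrow> real \<Rightarrow> real" where
  "adj \<alpha> p i s = \<alpha> * Q (wrap (p i s))"

definition execution ::
  "nat \<Rightarrow> (nat \<Rightarrow> nat \<Rightarrow> bool) \<Rightarrow> real \<Rightarrow> real \<Rightarrow> real \<Rightarrow> real \<Rightarrow> (nat \<Rightarrow> real)
   \<Rightarrow> (nat \<Rightarrow> real \<Rightarrow> real) \<Rightarrow> (nat \<Rightarrow> real \<Rightarrow> real) \<Rightarrow> bool" where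
  "execution N E \<omega>0 \<omega>max \<alpha> D \<theta>0 p w \<longleftrightarrow>
     (\<forall>i<N.
        p i 0 = \<theta>0 i \<and>
        continuous_on {0..} (p i) \<and>
        (\<forall>t\<ge>0. (p i has_real_derivative w i t) (at_right t)) \<and>
        (\<forall>t\<ge>0.
           let A = accepted N E D p i in
           (\<exists>s\<in>A. s \<le> t \<and> (\<forall>s'\<in>A. s' \<le> t \<longrightarrow> s' \<le> s) \<and>
                   t < s + \<bar>adj \<alpha> p i s\<bar> / \<omega>max \<and>
                   w i t = \<omega>0 + sgn (adj \<alpha> p i s) * \<omega>max)
           \<or>
           (\<not> (\<exists>s\<in>A. s \<le> t \<and> (\<forall>s'\<in>A. s' \<le> t \<longrightarrow> s' \<le> s) \<and>
                   t < s + \<bar>adj \<alpha> p i s\<bar> / \<omega>max) \<and>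
            w i t = \<omega>0)))"

definition heading :: "real \<Rightarrow> (nat \<Rightarrow> real \<Rightarrow> real) \<Rightarrow> nat \<Rightarrow> real \<Rightarrow> real" where
  "heading \<omega>0 p i t = wrap (p i t - \<omega>0 * t)"

end

theory Submission
  imports Defs "HOL-Analysis.Analysis"
begin

text \<open>
  Unwrap the headings, so that they start in an interval shorter than \<open>\<pi>\<close>.  An adjustment moves
  a heading towards, and never past, the heading its sender had when it fired; so all headings stay
  in the interval, and each robot fires exactly once in each round.

  Let robot \<open>j\<close> fire before its neighbour \<open>i\<close> in a round.  Then \<open>i\<close> lags, accepts the pulse (this is
  where \<open>D \<le> 2\<pi> - \<Lambda>\<close> enters), and closes a fixed share of the lag before it fires itself.  Along
  paths of the graph this gives: if \<open>m\<close> is a lower bound of the headings in a round, the lowest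
  firing heading exceeds \<open>m\<close> by a fixed share \<open>C\<close> of the excess of the highest one.

  The arc need not shrink monotonically, since a pending adjustment may aim at an outdated, lower
  heading.  Let \<open>L\<close> be the limit inferior of the lowest firing headings.  Rounds with lowest firing
  heading near \<open>L\<close> recur, and in these all firing headings are near \<open>L\<close>.  If a later round had one
  firing heading clearly above \<open>L\<close>, then in the first such round all of them would exceed \<open>L\<close> by a
  definite amount; as pending adjustments are small by then and completed within one period, no
  heading would ever come back to \<open>L\<close>, a contradiction.
\<close>

subsection \<open>Functions with a right derivative\<close>

text \<open>Only right derivatives are available, since rates jump at pulses, so a supremum argument
  replaces the mean value theorem. At the last point of \<open>S\<close> the strict slope bound
  would carry the inequality a little further, unless that point is \<open>b\<close>.\<close>

lemma right_derivative_le_closed: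
  fixes f g :: "real \<Rightarrow> real"
  assumes "a \<le> b" and cont: "continuous_on {a..b} f"
    and der: "\<And>t. a \<le> t \<Longrightarrow> t < b \<Longrightarrow> (f has_real_derivative g t) (at_right t)"
    and bd: "\<And>t. a \<le> t \<Longrightarrow> t < b \<Longrightarrow> g t < c"
  shows "f b - f a \<le> c * (b - a)"
proof -
  define S where "S = {t \<in> {a..b}. f t - c * t \<le> f a - c * a}"
  have "closed S"
    unfolding S_def by (intro continuous_on_closed_Collect_le continuous_intros cont)
  have aS: "a \<in> S" using \<open>a \<le> b\<close> by (simp add: S_def)
  have bdd: "bdd_above S" by (rule bdd_aboveI[of _ b]) (simp add: S_def)
  define m where "m = Sup S"
  have mS: "m \<in> S"
    unfolding m_def using closed_contains_Sup[OF _ bdd \<open>closed S\<close>] aS by blast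
  have "m = b"
  proof (rule ccontr)
    assume "m \<noteq> b"
    with mS have m: "a \<le> m" "m < b" by (auto simp: S_def)
    have "((\<lambda>t. f t - c * t) has_real_derivative (g m - c)) (at_right m)"
      by (auto intro!: derivative_eq_intros der m)
    moreover have "g m - c < 0" using bd m by simp
    ultimately obtain d where d: "d > 0"
      "\<And>h. h > 0 \<Longrightarrow> m + h \<in> {m<..} \<Longrightarrow> h < d \<Longrightarrow> f (m + h) - c * (m + h) < f m - c * m"
      using has_real_derivative_neg_dec_right by blast
    define h where "h = min (d / 2) (b - m)"
    have h: "h > 0" "h < d" "m + h \<le> b" using d m by (auto simp: h_def)
    then have "m + h \<in> S" using d(2)[of h] mS m by (auto simp: S_def)
    then have "m + h \<le> m" unfolding m_def using bdd cSup_upper by blast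
    with h show False by simp
  qed
  with mS show ?thesis by (auto simp: S_def algebra_simps)
qed

text \<open>The weaker hypotheses are recovered by two limits: the slope is relaxed to
  \<open>c + e\<close>, and the start \<open>x > a\<close> is moved down to \<open>a\<close> by
  continuity.\<close>

lemma right_derivative_le:
  fixes f g :: "real \<Rightarrow> real"
  assumes "a \<le> b" and cont: "continuous_on {a..b} f"
    and der: "\<And>t. a < t \<Longrightarrow> t < b \<Longrightarrow> (f has_real_derivative g t) (at_right t)"
    and bd: "\<And>t. a < t \<Longrightarrow> t < b \<Longrightarrow> g t \<le> c"
  shows "f b - f a \<le> c * (b - a)"
proof (cases "a = b")
  case False
  with \<open>a \<le> b\<close> have "a < b" by simp
  have *: "f b - f x \<le> (c + e) * (b - x)" if "a < x" "x < b" "0 < e" for x e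
  proof (rule right_derivative_le_closed[where g = g])
    show "continuous_on {x..b} f" using cont that by (auto elim: continuous_on_subset)
    show "g t < c + e" if "x \<le> t" "t < b" for t using bd[of t] that \<open>a < x\<close> \<open>0 < e\<close> by simp
  qed (use that der in auto)
  have **: "f b - f x \<le> c * (b - x)" if "a < x" "x < b" for x
  proof (rule field_le_epsilon)
    fix e :: real assume "0 < e"
    then have "f b - f x \<le> (c + e / (b - x)) * (b - x)" using *[of x "e / (b - x)"] that by simp
    also have "\<dots> = c * (b - x) + e" using that by (simp add: distrib_right)
    finally show "f b - f x \<le> c * (b - x) + e" .
  qed
  have lim: "((\<lambda>x. f x - c * x) \<longlongrightarrow> f a - c * a) (at_right a)"
  proof -
    have "continuous_on {a..b} (\<lambda>x. f x - c * x)" by (intro continuous_intros cont)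
    then have "((\<lambda>x. f x - c * x) \<longlongrightarrow> f a - c * a) (at a within {a..b})"
      using \<open>a < b\<close> by (auto simp: continuous_on_def)
    then show ?thesis using \<open>a < b\<close> by (simp add: at_within_Icc_at_right)
  qed
  have "f b - c * b \<le> f a - c * a"
  proof (rule tendsto_lowerbound[OF lim])
    show "\<forall>\<^sub>F x in at_right a. f b - c * b \<le> f x - c * x"
      unfolding eventually_at_right_field
      using \<open>a < b\<close> ** by (intro exI[of _ b]) (auto simp: algebra_simps)
  qed simp
  then show ?thesis by (simp add: algebra_simps)
qed simp

lemma right_derivative_ge:
  fixes f g :: "real \<Rightarrow> real"
  assumes "a \<le> b" "continuous_on {a..b} f"
    and "\<And>t. a < t \<Longrightarrow> t < b \<Longrightarrow> (f has_real_derivative g t) (at_right t)"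
    and "\<And>t. a < t \<Longrightarrow> t < b \<Longrightarrow> c \<le> g t"
  shows "c * (b - a) \<le> f b - f a"
proof -
  have "- f b - - f a \<le> - c * (b - a)"
    by (rule right_derivative_le[of a b "\<lambda>t. - f t" "\<lambda>t. - g t" "- c"])
       (use assms in \<open>auto intro: continuous_on_minus DERIV_minus\<close>)
  then show ?thesis by simp
qed

text \<open>After the last time with \<open>f \<le> c\<close> the function is above
  \<open>c\<close>, hence nonincreasing, hence still at most \<open>c\<close>.\<close>

lemma right_derivative_barrier_le:
  fixes f g :: "real \<Rightarrow> real"
  assumes "a \<le> b" and cont: "continuous_on {a..b} f"
    and der: "\<And>t. a < t \<Longrightarrow> t < b \<Longrightarrow> (f has_real_derivative g t) (at_right t)"
    and "f a \<le> c"
    and bd: "\<And>t. a < t \<Longrightarrow> t < b \<Longrightarrow> c < f t \<Longrightarrow> g t \<le> 0"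
  shows "f b \<le> c"
proof -
  define S where "S = {t \<in> {a..b}. f t \<le> c}"
  have "closed S"
    unfolding S_def by (intro continuous_on_closed_Collect_le continuous_intros cont)
  have aS: "a \<in> S" using assms by (simp add: S_def)
  have bdd: "bdd_above S" by (rule bdd_aboveI[of _ b]) (simp add: S_def)
  define m where "m = Sup S"
  have mS: "m \<in> S"
    unfolding m_def using closed_contains_Sup[OF _ bdd \<open>closed S\<close>] aS by blast
  then have m: "a \<le> m" "m \<le> b" "f m \<le> c" by (auto simp: S_def)
  have gt: "c < f t" if "m < t" "t \<le> b" for t
  proof (rule ccontr)
    assume "\<not> c < f t"
    then have "t \<in> S" using that m by (auto simp: S_def)
    then have "t \<le> m" unfolding m_def using bdd cSup_upper by blast
    with that show False by simp
  qed
  have "f b - f m \<le> 0 * (b - m)"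
    by (rule right_derivative_le[where g = g])
       (use m gt bd der in \<open>auto intro: continuous_on_subset[OF cont]\<close>)
  with m show ?thesis by simp
qed

lemma right_derivative_barrier_ge:
  fixes f g :: "real \<Rightarrow> real"
  assumes "a \<le> b" "continuous_on {a..b} f"
    and "\<And>t. a < t \<Longrightarrow> t < b \<Longrightarrow> (f has_real_derivative g t) (at_right t)"
    and "c \<le> f a"
    and "\<And>t. a < t \<Longrightarrow> t < b \<Longrightarrow> f t < c \<Longrightarrow> 0 \<le> g t"
  shows "c \<le> f b"
proof -
  have "- f b \<le> - c"
    by (rule right_derivative_barrier_le[of a b "\<lambda>t. - f t" "\<lambda>t. - g t" "- c"])
       (use assms in \<open>auto intro: continuous_on_minus DERIV_minus\<close>)
  then show ?thesis by simp
qed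

lemma right_derivative_unique:
  fixes f :: "real \<Rightarrow> real"
  assumes "(f has_real_derivative d) (at_right t)" "(f has_real_derivative e) (at_right t)"
  shows "d = e"
  using assms unfolding has_field_derivative_iff
  by (rule tendsto_unique[rotated]) simp

section \<open>Reduction modulo a full turn\<close>

lemma wrap_eqI:
  assumes "2 * pi * of_int k \<le> x" "x < 2 * pi * of_int k + 2 * pi"
  shows "wrap x = x - 2 * pi * of_int k"
proof -
  have "\<lfloor>x / (2 * pi)\<rfloor> = k"
    using assms by (intro floor_unique) (auto simp: field_simps)
  then show ?thesis by (simp add: wrap_def)
qed

lemma wrap_decomp: "x = wrap x + 2 * pi * of_int \<lfloor>x / (2 * pi)\<rfloor>"
  by (simp add: wrap_def)

lemma wrap_bounds: "0 \<le> wrap x" "wrap x < 2 * pi"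
proof -
  have "wrap x = 2 * pi * frac (x / (2 * pi))"
    by (simp add: wrap_def frac_def right_diff_distrib)
  then show "0 \<le> wrap x" "wrap x < 2 * pi"
    using frac_lt_1[of "x / (2 * pi)"] by simp_all
qed

lemma wrap_shift: "wrap (x + 2 * pi * of_int k) = wrap x"
proof -
  have "(x + 2 * pi * of_int k) / (2 * pi) = x / (2 * pi) + of_int k" by (simp add: field_simps)
  then show ?thesis by (simp add: wrap_def algebra_simps)
qed

subsection \<open>The containing arc\<close>

text \<open>The first entry at or above \<open>v\<close> has a predecessor, which must lie at or
  below \<open>u\<close>.\<close>

lemma sorted_gap:
  fixes xs :: "real list"
  assumes "sorted xs" "\<And>x. x \<in> set xs \<Longrightarrow> x \<le> u \<or> v \<le> x"
    and "a \<in> set xs" "a \<le> u" "b \<in> set xs" "v \<le> b" "u < v"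
  shows "\<exists>k. Suc k < length xs \<and> xs ! k \<le> u \<and> v \<le> xs ! Suc k"
proof -
  obtain m where m: "m < length xs" "xs ! m = b" using assms(5) by (auto simp: in_set_conv_nth)
  define k where "k = (LEAST k. k < length xs \<and> v \<le> xs ! k)"
  have k: "k < length xs" "v \<le> xs ! k"
    using LeastI[of "\<lambda>k. k < length xs \<and> v \<le> xs ! k" m] m assms(6) by (auto simp: k_def)
  obtain l where l: "l < length xs" "xs ! l = a" using assms(3) by (auto simp: in_set_conv_nth)
  have "k \<noteq> 0"
  proof
    assume "k = 0"
    then have "xs ! k \<le> xs ! l" using sorted_nth_mono[OF assms(1), of k l] l by simp
    with k l assms show False by simp
  qed
  then obtain j where j: "k = Suc j" by (cases k) auto
  have "\<not> v \<le> xs ! j"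
    using not_less_Least[of j "\<lambda>k. k < length xs \<and> v \<le> xs ! k"] j k by (auto simp: k_def)
  then have "xs ! j \<le> u" using assms(2)[of "xs ! j"] j k by auto
  with j k show ?thesis by blast
qed

text \<open>The gap list inside \<open>arc_len\<close>, as a function of the sorted values. The last
  entry is the gap across the angle 0.\<close>

definition gaps :: "real list \<Rightarrow> real list" where
  "gaps xs = map (\<lambda>k. xs ! (k + 1) - xs ! k) [0..<length xs - 1] @ [2 * pi - (last xs - hd xs)]"

lemma arc_len_gaps: "arc_len N x = 2 * pi - Max (set (gaps (sort (map x [0..<N]))))"
  by (simp add: arc_len_def gaps_def Let_def)

lemma set_gaps:
  "set (gaps xs) = insert (2 * pi - (last xs - hd xs)) {xs ! Suc k - xs ! k |k. Suc k < length xs}"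
  by (auto simp: gaps_def)

text \<open>Any single gap suffices for an upper estimate, so the largest one never has to be
  identified for this purpose.\<close>

lemma arc_len_le:
  assumes "g \<in> set (gaps (sort (map x [0..<N])))"
  shows "arc_len N x \<le> 2 * pi - g"
  using assms by (simp add: arc_len_gaps)

lemma sorted_hd_last:
  assumes "sorted xs" "x \<in> set xs"
  shows "hd xs \<le> x \<and> x \<le> last xs"
proof -
  obtain m where m: "m < length xs" "xs ! m = x" using assms(2) by (auto simp: in_set_conv_nth)
  then have "xs \<noteq> []" by auto
  then have "hd xs = xs ! 0" "last xs = xs ! (length xs - 1)" by (simp_all add: hd_conv_nth last_conv_nth)
  then show ?thesis
    using sorted_nth_mono[OF assms(1), of 0 m] sorted_nth_mono[OF assms(1), of m "length xs - 1"] m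
    by simp
qed

lemma arc_len_nonneg:
  assumes "0 < N" "\<And>i. i < N \<Longrightarrow> 0 \<le> x i \<and> x i < 2 * pi"
  shows "0 \<le> arc_len N x"
proof -
  let ?xs = "sort (map x [0..<N])"
  have ne: "?xs \<noteq> []" using assms(1) by (simp flip: length_greater_0_conv)
  have range: "0 \<le> y \<and> y < 2 * pi" if "y \<in> set ?xs" for y using that assms(2) by auto
  have "hd ?xs \<le> last ?xs" using sorted_hd_last[OF _ hd_in_set[OF ne]] by simp
  moreover have "?xs ! Suc k - ?xs ! k \<le> 2 * pi" if "Suc k < length ?xs" for k
    using range[OF nth_mem[OF that]] range[OF nth_mem[of k ?xs]] that by simp
  ultimately have "g \<le> 2 * pi" if "g \<in> set (gaps ?xs)" for g
    using that unfolding set_gaps by auto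
  moreover have "set (gaps ?xs) \<noteq> {}" by (simp add: set_gaps)
  ultimately have "Max (set (gaps ?xs)) \<le> 2 * pi" by (intro Max.boundedI) auto
  then show ?thesis by (simp add: arc_len_gaps)
qed

text \<open>A gap of size at least \<open>2 * pi - l\<close> has to be exhibited. If the sorted
  values spread over at most \<open>l\<close>, it is the gap across 0. Otherwise the interval runs
  over a multiple of \<open>2 * pi\<close>, and the gap lies between the points of turn
  \<open>K + 1\<close> and those of turn \<open>K\<close>.\<close>

lemma arc_len_wrap_le:
  assumes "0 < N" "\<And>i. i < N \<Longrightarrow> a \<le> y i \<and> y i \<le> a + l" "l < 2 * pi"
  shows "arc_len N (\<lambda>i. wrap (y i)) \<le> l"
proof -
  define xs where "xs = sort (map (\<lambda>i. wrap (y i)) [0..<N])"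
  have set_xs: "set xs = (\<lambda>i. wrap (y i)) ` {..<N}" by (auto simp: xs_def)
  have ne: "xs \<noteq> []" using set_xs assms(1) by auto
  have sorted: "sorted xs" by (simp add: xs_def)
  define K where "K = \<lfloor>a / (2 * pi)\<rfloor>"
  have aK: "2 * pi * of_int K \<le> a" "a < 2 * pi * of_int K + 2 * pi"
    using wrap_bounds[of a] wrap_decomp[of a] by (auto simp: K_def)
  have same: "wrap (y i) = y i - 2 * pi * of_int K"
    if "i < N" "y i < 2 * pi * of_int K + 2 * pi" for i
    using that assms(2)[OF that(1)] aK by (intro wrap_eqI) auto
  have nxt: "wrap (y i) = y i - 2 * pi * of_int K - 2 * pi"
    if "i < N" "2 * pi * of_int K + 2 * pi \<le> y i" for i
  proof -
    have "wrap (y i) = y i - 2 * pi * of_int (K + 1)"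
      using that assms(2)[OF that(1)] assms(3) aK by (intro wrap_eqI) (auto simp: algebra_simps)
    then show ?thesis by (simp add: algebra_simps)
  qed
  obtain i j where ij: "i < N" "hd xs = wrap (y i)" "j < N" "last xs = wrap (y j)"
    using hd_in_set[OF ne] last_in_set[OF ne] unfolding set_xs by auto
  \<comment> \<open>Wrapping sends points of turn \<open>K + 1\<close> to values at most
    \<open>u\<close> and points of turn \<open>K\<close> to values at least \<open>v\<close>; here
    \<open>v - u = 2 * pi - l\<close>.\<close>
  define u where "u = a + l - 2 * pi * of_int K - 2 * pi"
  define v where "v = a - 2 * pi * of_int K"
  have uv: "u < v" using assms(3) by (simp add: u_def v_def)
  show ?thesis
  proof (cases "last xs - hd xs \<le> l")
    case True
    have "arc_len N (\<lambda>i. wrap (y i)) \<le> 2 * pi - (2 * pi - (last xs - hd xs))"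
      by (rule arc_len_le) (simp add: set_gaps xs_def)
    with True show ?thesis by simp
  next
    case False
    have or: "wrap (y m) \<le> u \<or> v \<le> wrap (y m)" if "m < N" for m
      using same[OF that] nxt[OF that] assms(2)[OF that] by (force simp: u_def v_def)
    then have or_xs: "r \<le> u \<or> v \<le> r" if "r \<in> set xs" for r
      using that unfolding set_xs by blast
    \<comment> \<open>Both sides of the gap are inhabited: otherwise all values would fit into
      \<open>[v, v + l]\<close> or into \<open>[0, u]\<close> with \<open>u < l\<close>, against the
      spread exceeding \<open>l\<close>.\<close>
    have "hd xs \<le> u"
    proof (rule ccontr)
      assume nu: "\<not> hd xs \<le> u"
      have "y i < 2 * pi * of_int K + 2 * pi"
        using nxt[OF ij(1)] assms(2)[OF ij(1)] nu ij(2) by (force simp: u_def)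
      then have "v \<le> hd xs" using same[OF ij(1)] assms(2)[OF ij(1)] ij(2) by (simp add: v_def)
      moreover have "last xs \<le> y j - 2 * pi * of_int K"
        using same[OF ij(3)] nxt[OF ij(3)] ij(4)
        by (cases "y j < 2 * pi * of_int K + 2 * pi") simp_all
      then have "last xs \<le> v + l" using assms(2)[OF ij(3)] by (simp add: v_def)
      ultimately show False using False by simp
    qed
    moreover have "v \<le> last xs"
    proof (rule ccontr)
      assume nv: "\<not> v \<le> last xs"
      then have "last xs \<le> u" using or[OF ij(3)] ij(4) by simp
      moreover have "0 \<le> hd xs" using ij(2) wrap_bounds by simp
      ultimately show False using False aK by (simp add: u_def)
    qed
    ultimately obtain k where k: "Suc k < length xs" "xs ! k \<le> u" "v \<le> xs ! Suc k"
      using sorted_gap[OF sorted or_xs hd_in_set[OF ne] _ last_in_set[OF ne] _ uv] by blast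
    have "arc_len N (\<lambda>i. wrap (y i)) \<le> 2 * pi - (xs ! Suc k - xs ! k)"
      by (rule arc_len_le) (use k(1) in \<open>auto simp: set_gaps xs_def\<close>)
    also have "\<dots> \<le> l" using k by (simp add: u_def v_def)
    finally show ?thesis .
  qed
qed

text \<open>Cutting the circle at the largest gap.\<close>
lemma arc_len_unwrap:
  assumes "0 < N" "\<And>i. i < N \<Longrightarrow> 0 \<le> x i \<and> x i < 2 * pi"
  obtains a z where "\<And>i. i < N \<Longrightarrow> a \<le> x i + 2 * pi * of_int (z i :: int) \<and>
    x i + 2 * pi * of_int (z i) \<le> a + arc_len N x"
proof -
  define xs where "xs = sort (map x [0..<N])"
  have set_xs: "set xs = x ` {..<N}" by (auto simp: xs_def)
  have sorted: "sorted xs" by (simp add: xs_def)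
  define g where "g = Max (set (gaps xs))"
  have "g \<in> set (gaps xs)" unfolding g_def by (rule Max_in[OF finite_set]) (simp add: set_gaps)
  then consider "g = 2 * pi - (last xs - hd xs)"
    | k where "Suc k < length xs" "g = xs ! Suc k - xs ! k" by (auto simp: set_gaps)
  then show thesis
  proof cases
    case 1
    then have "arc_len N x = last xs - hd xs" by (simp add: arc_len_gaps g_def xs_def)
    then show thesis
      using sorted_hd_last[OF sorted] set_xs by (intro that[of "hd xs" "\<lambda>_. 0"]) auto
  next
    case (2 k)
    then have len: "arc_len N x = 2 * pi - (xs ! Suc k - xs ! k)"
      by (simp add: arc_len_gaps g_def xs_def)
    \<comment> \<open>With an inner largest gap the circle is cut there: values up to its start are
      moved up by one turn, so that the arc begins at its end.\<close>
    show thesis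
    proof (rule that[of "xs ! Suc k" "\<lambda>i. if x i \<le> xs ! k then 1 else 0"])
      fix i assume i: "i < N"
      then obtain m where m: "m < length xs" "xs ! m = x i"
        using set_xs by (metis imageI in_set_conv_nth lessThan_iff)
      have top: "xs ! Suc k < 2 * pi" "0 \<le> xs ! k"
        using nth_mem[of "Suc k" xs] nth_mem[of k xs] 2(1) assms(2) unfolding set_xs by auto
      show "xs ! Suc k \<le> x i + 2 * pi * of_int (if x i \<le> xs ! k then 1 else 0) \<and>
          x i + 2 * pi * of_int (if x i \<le> xs ! k then 1 else 0) \<le> xs ! Suc k + arc_len N x"
      proof (cases "x i \<le> xs ! k")
        case True
        then show ?thesis using top assms(2)[OF i] by (simp add: len)
      next
        case False
        then have "k < m" using sorted_nth_mono[OF sorted, of m k] m 2(1) by (auto simp: not_le[symmetric])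
        then have "xs ! Suc k \<le> x i" using sorted_nth_mono[OF sorted, of "Suc k" m] m by simp
        then show ?thesis using False top assms(2)[OF i] by (simp add: len)
      qed
    qed
  qed
qed

subsection \<open>Pulse-coupled executions\<close>

lemma fires_shift:
  "fires (\<lambda>i t. p i t + 2 * pi * of_int (z i)) j s \<longleftrightarrow> fires p j s"
proof -
  have "(\<exists>k::int. p j s + 2 * pi * of_int (z j) = 2 * pi * of_int k) \<longleftrightarrow>
      (\<exists>k::int. p j s = 2 * pi * of_int k)"
  proof safe
    fix k :: int
    show "\<exists>k::int. p j s = 2 * pi * of_int k" if "p j s + 2 * pi * of_int (z j) = 2 * pi * of_int k"
      using that by (intro exI[of _ "k - z j"]) (simp add: algebra_simps)
    show "\<exists>k'::int. p j s + 2 * pi * of_int (z j) = 2 * pi * of_int k'" if "p j s = 2 * pi * of_int k"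
      using that by (intro exI[of _ "k + z j"]) (simp add: algebra_simps)
  qed
  then show ?thesis by (simp add: fires_def)
qed

text \<open>Pulses, acceptance and adjustments depend on phases modulo a full turn only. This
  permits the choice of representatives that lie close together on the real line.\<close>

lemma execution_shift:
  assumes "execution N E \<omega>0 \<omega>max \<alpha> D \<theta> p w"
  shows "execution N E \<omega>0 \<omega>max \<alpha> D (\<lambda>i. \<theta> i + 2 * pi * of_int (z i))
    (\<lambda>i t. p i t + 2 * pi * of_int (z i)) w"
proof -
  let ?p = "\<lambda>i t. p i t + 2 * pi * of_int (z i)"
  have acc: "accepted N E D ?p i = accepted N E D p i" for i
    by (simp add: accepted_def fires_shift wrap_shift)
  have adj: "adj \<alpha> ?p i s = adj \<alpha> p i s" for i s
    by (simp add: adj_def wrap_shift)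
  have cont: "continuous_on {0..} (?p i)" if "continuous_on {0..} (p i)" for i
    using that by (intro continuous_on_add continuous_on_const)
  have der: "(?p i has_real_derivative d) (at_right t)"
    if "(p i has_real_derivative d) (at_right t)" for i d t
    using DERIV_add[OF that DERIV_const[of "2 * pi * of_int (z i)"]] by simp
  show ?thesis
    using assms cont der unfolding execution_def acc adj by simp
qed

section \<open>Rates and adjustments of a single robot\<close>

locale pulse_coupled =
  fixes N :: nat and E :: "nat \<Rightarrow> nat \<Rightarrow> bool"
    and \<omega>0 \<omega>max \<alpha> D :: real
    and \<theta> :: "nat \<Rightarrow> real" and p w :: "nat \<Rightarrow> real \<Rightarrow> real"
  assumes exec: "execution N E \<omega>0 \<omega>max \<alpha> D \<theta> p w"
    and \<omega>0_pos: "0 < \<omega>0" and \<omega>max_pos: "0 < \<omega>max"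
    and \<alpha>_pos: "0 < \<alpha>" and \<alpha>_le_1: "\<alpha> \<le> 1"
begin

abbreviation A :: "nat \<Rightarrow> real set" where "A \<equiv> accepted N E D p"

text \<open>The heading before reduction modulo \<open>2 * pi\<close>.\<close>

definition q :: "nat \<Rightarrow> real \<Rightarrow> real" where "q i t = p i t - \<omega>0 * t"

text \<open>Names the condition shared by the two alternatives of \<open>execution\<close>: the
  pulse at \<open>s\<close> is the one that drives robot \<open>i\<close> at time
  \<open>t\<close>.\<close>

definition active :: "nat \<Rightarrow> real \<Rightarrow> real \<Rightarrow> bool" where
  "active i s t \<longleftrightarrow> s \<in> A i \<and> s \<le> t \<and> (\<forall>s'\<in>A i. s' \<le> t \<longrightarrow> s' \<le> s) \<and>
     t < s + \<bar>adj \<alpha> p i s\<bar> / \<omega>max"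

lemmas exec_robot = exec[unfolded execution_def Let_def, THEN spec, THEN mp]

lemma p_cont:
  assumes "i < N" "0 \<le> a"
  shows "continuous_on {a..b} (p i)"
proof (rule continuous_on_subset)
  show "continuous_on {0..} (p i)" using exec_robot[OF \<open>i < N\<close>] by (elim conjE)
qed (use \<open>0 \<le> a\<close> in auto)

lemma q_cont: "i < N \<Longrightarrow> 0 \<le> a \<Longrightarrow> continuous_on {a..b} (q i)"
  unfolding q_def by (intro continuous_on_diff continuous_on_mult continuous_on_const continuous_on_id p_cont)

lemma p_deriv: "i < N \<Longrightarrow> 0 \<le> t \<Longrightarrow> (p i has_real_derivative w i t) (at_right t)"
  using exec_robot by meson

lemma q_deriv: "i < N \<Longrightarrow> 0 \<le> t \<Longrightarrow> (q i has_real_derivative (w i t - \<omega>0)) (at_right t)"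
  unfolding q_def by (rule DERIV_diff[OF p_deriv DERIV_cmult_Id])

lemma rate_cases:
  assumes "i < N" "0 \<le> t"
  shows "(\<exists>s. active i s t \<and> w i t = \<omega>0 + sgn (adj \<alpha> p i s) * \<omega>max) \<or>
    (\<nexists>s. active i s t) \<and> w i t = \<omega>0"
  using exec_robot[OF \<open>i < N\<close>, THEN conjunct2, THEN conjunct2, THEN conjunct2, THEN spec, THEN mp,
    OF \<open>0 \<le> t\<close>]
  unfolding active_def by blast

lemma active_unique: "active i s t \<Longrightarrow> active i s' t \<Longrightarrow> s = s'"
  unfolding active_def by (meson order_antisym)

lemma rate_active:
  assumes "i < N" "0 \<le> t" "active i s t"
  shows "w i t = \<omega>0 + sgn (adj \<alpha> p i s) * \<omega>max"
  using rate_cases[OF assms(1,2)] active_unique assms(3) by blast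

lemma rate_inactive: "i < N \<Longrightarrow> 0 \<le> t \<Longrightarrow> w i t \<noteq> \<omega>0 \<Longrightarrow> \<exists>s. active i s t"
  using rate_cases by blast

lemma active_earlier: "active i s t \<Longrightarrow> s \<le> u \<Longrightarrow> u \<le> t \<Longrightarrow> active i s u"
  unfolding active_def by auto

lemma accepted_pos: "s \<in> A i \<Longrightarrow> 0 < s"
  unfolding accepted_def fires_def by auto

lemma active_le: "active i s t \<Longrightarrow> s \<le> t"
  and active_pos: "active i s t \<Longrightarrow> 0 < s"
  and active_accepted: "active i s t \<Longrightarrow> s \<in> A i"
  unfolding active_def by (auto intro: accepted_pos)

text \<open>The same pulse is in force from \<open>s\<close> to \<open>t\<close>, so the slope is
  constant and the upper and lower slope bounds coincide.\<close>

lemma q_active: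
  assumes "i < N" "active i s t" "s \<le> u" "u \<le> t"
  shows "q i u = q i s + sgn (adj \<alpha> p i s) * \<omega>max * (u - s)"
proof -
  let ?c = "sgn (adj \<alpha> p i s) * \<omega>max"
  have s: "0 < s" using assms active_pos by blast
  have *: "w i v - \<omega>0 = ?c" if "s < v" "v < u" for v
    using rate_active[OF \<open>i < N\<close> _ active_earlier[OF assms(2)], of v] that s assms by simp
  have der: "(q i has_real_derivative (w i v - \<omega>0)) (at_right v)" if "s < v" for v
    using q_deriv assms that s by simp
  have "q i u - q i s \<le> ?c * (u - s)"
    by (rule right_derivative_le[OF _ _ der]) (use assms s * in \<open>auto intro: q_cont\<close>)
  moreover have "?c * (u - s) \<le> q i u - q i s"
    by (rule right_derivative_ge[OF _ _ der]) (use assms s * in \<open>auto intro: q_cont\<close>)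
  ultimately show ?thesis by simp
qed

lemma rate_bound: "i < N \<Longrightarrow> 0 \<le> t \<Longrightarrow> \<bar>w i t - \<omega>0\<bar> \<le> \<omega>max"
  using rate_cases[of i t] \<omega>max_pos by (auto simp: sgn_real_def)

lemma adj_bound: "\<bar>adj \<alpha> p i s\<bar> \<le> pi"
proof -
  have "\<bar>Q (wrap (p i s))\<bar> \<le> pi" using wrap_bounds[of "p i s"] by (auto simp: Q_def)
  then have "\<alpha> * \<bar>Q (wrap (p i s))\<bar> \<le> 1 * pi" using \<alpha>_pos \<alpha>_le_1 by (intro mult_mono) auto
  then show ?thesis using \<alpha>_pos by (simp add: adj_def abs_mult)
qed

text \<open>Adjustments are at most \<open>pi\<close> in size, so the influence of a pulse ends
  after the time \<open>pi / \<omega>max\<close>.\<close>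

lemma active_recent: "active i s t \<Longrightarrow> t - pi / \<omega>max < s"
proof -
  assume "active i s t"
  then have "t < s + \<bar>adj \<alpha> p i s\<bar> / \<omega>max" by (simp add: active_def)
  also have "\<dots> \<le> s + pi / \<omega>max"
    using adj_bound \<omega>max_pos by (simp add: divide_right_mono)
  finally show ?thesis by simp
qed

text \<open>A negative adjustment never brings the phase back to 0, because it is at most the
  phase itself.\<close>
lemma rate_pos_at_reset:
  assumes "i < N" "0 \<le> t" and level: "p i t = 2 * pi * of_int k"
  shows "0 < w i t"
proof (rule ccontr)
  assume neg: "\<not> 0 < w i t"
  then obtain s where s: "active i s t" using rate_inactive assms \<omega>0_pos by fastforce
  have w: "w i t = \<omega>0 + sgn (adj \<alpha> p i s) * \<omega>max" using rate_active assms s by blast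
  with neg \<omega>0_pos \<omega>max_pos have sg: "sgn (adj \<alpha> p i s) = - 1"
    by (auto simp: sgn_real_def split: if_splits)
  with w neg have "\<omega>0 \<le> \<omega>max" by simp
  define \<phi> where "\<phi> = wrap (p i s)"
  obtain m where m: "p i s = \<phi> + 2 * pi * of_int m" using wrap_decomp \<phi>_def by blast
  have \<phi>: "0 \<le> \<phi>" "\<phi> < 2 * pi" using wrap_bounds by (auto simp: \<phi>_def)
  have "adj \<alpha> p i s < 0" using sg by (simp add: sgn_real_def split: if_splits)
  then have "Q \<phi> < 0" using \<alpha>_pos by (simp add: adj_def \<phi>_def mult_less_0_iff)
  then have Q: "Q \<phi> = - \<phi>" "0 < \<phi>" using \<phi> by (auto simp: Q_def split: if_splits)
  then have "\<bar>adj \<alpha> p i s\<bar> = \<alpha> * \<phi>" using \<alpha>_pos by (simp add: adj_def \<phi>_def abs_mult)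
  then have "t - s < \<alpha> * \<phi> / \<omega>max" using s by (simp add: active_def)
  then have d: "\<omega>max * (t - s) < \<alpha> * \<phi>" using \<omega>max_pos by (simp add: field_simps)
  have "\<alpha> * \<phi> \<le> 1 * \<phi>" using \<phi> \<alpha>_le_1 by (intro mult_right_mono)
  have "p i t = p i s + (\<omega>0 - \<omega>max) * (t - s)"
    using q_active[OF \<open>i < N\<close> s active_le[OF s] order_refl] sg by (simp add: q_def algebra_simps)
  then have pt: "p i t = \<phi> + 2 * pi * of_int m - (\<omega>max - \<omega>0) * (t - s)" 
    using m by (simp add: algebra_simps)
  have "0 \<le> (\<omega>max - \<omega>0) * (t - s)" using \<open>\<omega>0 \<le> \<omega>max\<close> active_le[OF s] by simp
  moreover have "(\<omega>max - \<omega>0) * (t - s) < \<phi>"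
  proof -
    have "(\<omega>max - \<omega>0) * (t - s) \<le> \<omega>max * (t - s)"
      using \<omega>0_pos active_le[OF s] by (intro mult_right_mono) auto
    with d \<open>\<alpha> * \<phi> \<le> 1 * \<phi>\<close> show ?thesis by simp
  qed
  ultimately have "2 * pi * of_int m < p i t" "p i t < 2 * pi * of_int m + 2 * pi"
    using pt \<phi> by auto
  then have "2 * pi * of_int m < 2 * pi * of_int k"
    "2 * pi * of_int k < 2 * pi * (of_int m + 1)"
    using level by (auto simp: algebra_simps)
  then have "real_of_int m < of_int k" "real_of_int k < of_int (m + 1)" by auto
  then have "m < k" "k < m + 1" unfolding of_int_less_iff by auto
  then show False by simp
qed

text \<open>At the last time at or above the level, continuity puts the phase exactly on it; there
  the rate is positive, so the phase would rise above the level once more. Hence no level is ever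
  lost again.\<close>

lemma stays_above_level:
  assumes "i < N" "0 \<le> a" "a \<le> t" and level: "2 * pi * of_int k \<le> p i a"
  shows "2 * pi * of_int k \<le> p i t"
proof (rule ccontr)
  let ?l = "2 * pi * of_int k"
  assume lt: "\<not> ?l \<le> p i t"
  define S where "S = {u \<in> {a..t}. ?l \<le> p i u}"
  have "closed S" unfolding S_def
    by (intro continuous_on_closed_Collect_le continuous_on_const p_cont closed_atLeastAtMost) (use assms in auto)
  have aS: "a \<in> S" using assms level by (simp add: S_def)
  have bdd: "bdd_above S" by (rule bdd_aboveI[of _ t]) (simp add: S_def)
  define m where "m = Sup S"
  have mS: "m \<in> S"
    unfolding m_def using closed_contains_Sup[OF _ bdd \<open>closed S\<close>] aS by blast
  then have m: "a \<le> m" "m < t" "?l \<le> p i m"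
    using lt by (auto simp: S_def less_le)
  have after: "p i u < ?l" if "m < u" "u \<le> t" for u
  proof (rule ccontr)
    assume "\<not> p i u < ?l"
    then have "u \<in> S" using that m by (auto simp: S_def)
    then have "u \<le> m" unfolding m_def using bdd cSup_upper by blast
    with that show False by simp
  qed
  have "p i m = ?l"
  proof (rule ccontr)
    assume "p i m \<noteq> ?l"
    then have less: "?l < p i m" using m by simp
    have "continuous_on {m..t} (p i)" using p_cont assms m by simp
    moreover have "p i t < ?l" using after[of t] m by simp
    then have "p i t \<le> (?l + p i m) / 2" "(?l + p i m) / 2 \<le> p i m"
      using less by (simp_all add: field_simps)
    ultimately obtain x where x: "m \<le> x" "x \<le> t" "p i x = (?l + p i m) / 2"
      using IVT2'[of "p i" t "(?l + p i m) / 2" m] m by force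
    have "x \<noteq> m" using x less by auto
    then have "p i x < ?l" using x after[of x] by simp
    then show False using x less by (simp add: field_simps)
  qed
  then have "0 < w i m" using rate_pos_at_reset assms m by auto
  then obtain d where d: "d > 0"
    "\<And>h. h > 0 \<Longrightarrow> m + h \<in> {m<..} \<Longrightarrow> h < d \<Longrightarrow> p i m < p i (m + h)"
    using has_real_derivative_pos_inc_right[OF p_deriv[OF \<open>i < N\<close>, of m]] m \<open>0 \<le> a\<close>
    by (meson order_trans)
  define h where "h = min (d / 2) (t - m)"
  have h: "h > 0" "h < d" "m + h \<le> t" using d(1) m by (auto simp: h_def)
  with d(2)[of h] after[of "m + h"] \<open>p i m = ?l\<close> show False by force
qed

text \<open>An earlier visit to the level would keep the phase at or above it until
  \<open>s\<close>, whereas a firing approaches the level from below.\<close>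

lemma fires_first:
  assumes "i < N" "fires p i s" "p i s = 2 * pi * of_int k" "0 \<le> u" "u < s"
  shows "p i u < 2 * pi * of_int k"
proof (rule ccontr)
  assume u: "\<not> p i u < 2 * pi * of_int k"
  obtain e where e: "e > 0" "\<And>v. s - e < v \<Longrightarrow> v < s \<Longrightarrow> p i v < p i s"
    using assms(2) by (auto simp: fires_def)
  define v where "v = max u (s - e / 2)"
  have v: "u \<le> v" "v < s" "s - e < v" using e(1) \<open>u < s\<close> by (auto simp: v_def)
  have "2 * pi * of_int k \<le> p i v"
    using stays_above_level[OF \<open>i < N\<close> \<open>0 \<le> u\<close> v(1)] u by simp
  with e(2)[OF v(3,2)] assms(3) show False by simp
qed

section \<open>Uniqueness and local finiteness of firing times\<close>

lemma fires_pos: "fires p i s \<Longrightarrow> 0 < s"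
  by (simp add: fires_def)

lemma fires_unique:
  assumes "i < N" "fires p i s" "fires p i s'" "p i s = p i s'"
  shows "s = s'"
proof -
  obtain k :: int where "p i s = 2 * pi * of_int k" using assms by (auto simp: fires_def)
  then show ?thesis
    using fires_first[of i s k s'] fires_first[of i s' k s] fires_pos assms
    by (metis less_irrefl less_le linorder_less_linear)
qed

text \<open>The phase is bounded on a compact time interval, so it meets finitely many multiples of
  \<open>2 * pi\<close>, and each of them belongs to at most one firing.\<close>

lemma finite_fires:
  assumes "i < N"
  shows "finite {s. s \<le> T \<and> fires p i s}"
proof -
  have "compact (p i ` {0..T})"
    using p_cont[OF assms, of 0 T] by (intro compact_continuous_image) auto
  then obtain M where M: "\<And>t. 0 \<le> t \<Longrightarrow> t \<le> T \<Longrightarrow> \<bar>p i t\<bar> \<le> M"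
    using compact_imp_bounded bounded_iff by (metis atLeastAtMost_iff imageI real_norm_def)
  have "inj_on (p i) {s. s \<le> T \<and> fires p i s}"
    using fires_unique[OF assms] by (intro inj_onI) auto
  moreover have "p i ` {s. s \<le> T \<and> fires p i s} \<subseteq> (\<lambda>k. 2 * pi * of_int k) ` {- \<lceil>M\<rceil>..\<lceil>M\<rceil>}"
  proof clarify
    fix s assume s: "s \<le> T" "fires p i s"
    then obtain k :: int where k: "p i s = 2 * pi * of_int k" by (auto simp: fires_def)
    have "1 * \<bar>real_of_int k\<bar> \<le> 2 * pi * \<bar>real_of_int k\<bar>"
      using pi_gt3 by (intro mult_right_mono) auto
    also have "\<dots> = \<bar>p i s\<bar>" by (simp add: k abs_mult)
    also have "\<dots> \<le> M" using M s by (simp add: fires_def)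
    also have "M \<le> of_int \<lceil>M\<rceil>" by simp
    finally have "\<bar>real_of_int k\<bar> \<le> of_int \<lceil>M\<rceil>" by simp
    then have "\<bar>k\<bar> \<le> \<lceil>M\<rceil>" by linarith
    then have "k \<in> {- \<lceil>M\<rceil>..\<lceil>M\<rceil>}" by auto
    with k show "p i s \<in> (\<lambda>k. 2 * pi * of_int k) ` {- \<lceil>M\<rceil>..\<lceil>M\<rceil>}" by blast
  qed
  ultimately show ?thesis by (rule inj_on_finite) simp
qed

lemma finite_fires_all: "finite {s. s \<le> T \<and> (\<exists>j<N. fires p j s)}"
proof -
  have "{s. s \<le> T \<and> (\<exists>j<N. fires p j s)} = (\<Union>j<N. {s. s \<le> T \<and> fires p j s})" by auto
  then show ?thesis using finite_fires by simp
qed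

lemma accepted_fires: "s \<in> A i \<Longrightarrow> \<exists>j<N. fires p j s"
  unfolding accepted_def by auto

lemma last_accepted:
  assumes "s \<in> A i" "s \<le> t"
  obtains s' where "s' \<in> A i" "s \<le> s'" "s' \<le> t" "\<And>s''. s'' \<in> A i \<Longrightarrow> s'' \<le> t \<Longrightarrow> s'' \<le> s'"
proof -
  let ?S = "{s \<in> A i. s \<le> t}"
  have fin: "finite ?S"
    by (rule finite_subset[OF _ finite_fires_all[of t]]) (auto dest: accepted_fires)
  have "s \<in> ?S" using assms by simp
  then have "Max ?S \<in> ?S" using Max_in[OF fin] by blast
  then show thesis using that[of "Max ?S"] Max_ge[OF fin] \<open>s \<in> ?S\<close> by blast
qed

text \<open>A consequence of local finiteness, meant for arguments at an infimum of times: no new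
  pulse interferes immediately after it.\<close>

lemma no_fires_after:
  obtains \<eta> where "0 < \<eta>" "\<And>j s. j < N \<Longrightarrow> t < s \<Longrightarrow> s < t + \<eta> \<Longrightarrow> \<not> fires p j s"
proof -
  define F where "F = {s. s \<le> t + 1 \<and> (\<exists>j<N. fires p j s)} \<inter> {t<..}"
  define m where "m = Min (insert (t + 1) F)"
  have fin: "finite (insert (t + 1) F)" using finite_fires_all by (simp add: F_def)
  have "t < m" unfolding m_def using fin by (subst Min_gr_iff) (auto simp: F_def)
  moreover have "\<not> fires p j s" if "j < N" "t < s" "s < m" for j s
  proof
    assume "fires p j s"
    have "s < t + 1" using that fin by (simp add: m_def)
    then have "s \<in> F" using that \<open>fires p j s\<close> by (auto simp: F_def)
    then have "m \<le> s" using fin by (simp add: m_def)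
    with that show False by simp
  qed
  ultimately show thesis using that[of "m - t"] by simp
qed

text \<open>Up to sign, \<open>Q\<close> is the signed distance to the nearest multiple of
  \<open>2 * pi\<close>. Within distance \<open>pi\<close> of a level, the adjustment is therefore
  the share \<open>\<alpha>\<close> of the way to that level.\<close>

lemma adj_toward:
  assumes "\<bar>p i s - 2 * pi * of_int k\<bar> < pi"
  shows "adj \<alpha> p i s = \<alpha> * (2 * pi * of_int k - p i s)"
proof (cases "2 * pi * of_int k \<le> p i s")
  case True
  then have "wrap (p i s) = p i s - 2 * pi * of_int k"
    using assms by (intro wrap_eqI) auto
  then show ?thesis using assms by (simp add: adj_def Q_def)
next
  case False
  then have "wrap (p i s) = p i s - 2 * pi * of_int (k - 1)"
    using assms pi_gt_zero by (intro wrap_eqI) (auto simp: algebra_simps)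
  then have "wrap (p i s) = p i s - 2 * pi * of_int k + 2 * pi" by (simp add: algebra_simps)
  then show ?thesis using assms by (simp add: adj_def Q_def)
qed

text \<open>The adjustment covers at most the distance to the heading of the sender at
  \<open>s\<close>, because \<open>\<alpha> \<le> 1\<close>, and it is not yet completed at
  \<open>t\<close>. So the robot is still strictly on its original side of that heading and moves
  towards it.\<close>

lemma active_target:
  assumes "i < N" "active i s t" and close: "\<And>j. j < N \<Longrightarrow> \<bar>q i s - q j s\<bar> < pi"
  obtains j k where "j < N" "fires p j s" "p j s = 2 * pi * of_int k"
    "w i t = \<omega>0 - \<omega>max \<and> q j s < q i t \<or> w i t = \<omega>0 + \<omega>max \<and> q i t < q j s"
proof -
  obtain j where j: "j < N" "fires p j s"
    using active_accepted[OF assms(2)] accepted_fires by blast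
  then obtain k :: int where k: "p j s = 2 * pi * of_int k" by (auto simp: fires_def)
  \<comment> \<open>At one time, phases differ exactly as headings do, and the sender is on the
    level.\<close>
  have "\<bar>p i s - 2 * pi * of_int k\<bar> < pi" using close[OF j(1)] k by (simp add: q_def)
  then have adj: "adj \<alpha> p i s = \<alpha> * (q j s - q i s)"
    using adj_toward k by (simp add: q_def)
  have st: "0 < s" "s \<le> t" using assms active_pos active_le by auto
  have "t - s < \<bar>adj \<alpha> p i s\<bar> / \<omega>max" using assms(2) by (simp add: active_def)
  then have "\<omega>max * (t - s) < \<bar>adj \<alpha> p i s\<bar>" using \<omega>max_pos by (simp add: field_simps)
  also have "\<dots> \<le> 1 * \<bar>q j s - q i s\<bar>"
    using \<alpha>_pos \<alpha>_le_1 unfolding adj abs_mult by (intro mult_right_mono) auto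
  finally have less: "\<omega>max * (t - s) < \<bar>q j s - q i s\<bar>" by simp
  moreover have "0 \<le> \<omega>max * (t - s)" using st \<omega>max_pos by simp
  ultimately have ne: "q j s \<noteq> q i s" by auto
  have sg: "sgn (adj \<alpha> p i s) = sgn (q j s - q i s)"
    using \<alpha>_pos by (simp add: adj sgn_mult)
  have w: "w i t = \<omega>0 + sgn (q j s - q i s) * \<omega>max"
    using rate_active[of i t s] assms st by (simp add: sg)
  have qt: "q i t = q i s + sgn (q j s - q i s) * \<omega>max * (t - s)"
    using q_active[OF assms(1,2) st(2)] sg by simp
  show thesis
  proof (rule that[OF j k], cases "q j s < q i s")
    case True
    then show "w i t = \<omega>0 - \<omega>max \<and> q j s < q i t \<or> w i t = \<omega>0 + \<omega>max \<and> q i t < q j s"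
      using w qt less by simp
  next
    case False
    then have "sgn (q j s - q i s) = 1" using ne by simp
    then show "w i t = \<omega>0 - \<omega>max \<and> q j s < q i t \<or> w i t = \<omega>0 + \<omega>max \<and> q i t < q j s"
      using w qt less False by simp
  qed
qed

text \<open>Just after a first exit from the strip no robot fires, so every adjustment active there
  stems from a pulse inside the trapped period.\<close>
lemma trapping:
  assumes \<tau>: "\<And>i. i < N \<Longrightarrow> 0 \<le> \<tau> i"
    and init: "\<And>i. i < N \<Longrightarrow> b \<le> q i (\<tau> i) \<and> q i (\<tau> i) \<le> h"
    and step: "\<And>i s t. i < N \<Longrightarrow> \<tau> i \<le> t \<Longrightarrow> active i s t \<Longrightarrow>
        (\<And>j u. j < N \<Longrightarrow> \<tau> j \<le> u \<Longrightarrow> u \<le> s \<Longrightarrow> b \<le> q j u \<and> q j u \<le> h) \<Longrightarrow>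
        (w i t < \<omega>0 \<longrightarrow> b \<le> q i t) \<and> (\<omega>0 < w i t \<longrightarrow> q i t \<le> h)"
    and "i < N" "\<tau> i \<le> t"
  shows "b \<le> q i t \<and> q i t \<le> h"
proof (rule ccontr)
  assume viol: "\<not> (b \<le> q i t \<and> q i t \<le> h)"
  define Bad where "Bad = {t. \<exists>i<N. \<tau> i \<le> t \<and> \<not> (b \<le> q i t \<and> q i t \<le> h)}"
  have ne: "Bad \<noteq> {}" using viol \<open>i < N\<close> \<open>\<tau> i \<le> t\<close> by (auto simp: Bad_def)
  have bdd: "bdd_below Bad"
  proof (rule bdd_belowI)
    show "0 \<le> t" if "t \<in> Bad" for t using that \<tau> unfolding Bad_def by (auto intro: order_trans)
  qed
  define T where "T = Inf Bad"
  have before: "b \<le> q j u \<and> q j u \<le> h" if "j < N" "\<tau> j \<le> u" "u < T" for j u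
  proof (rule ccontr)
    assume "\<not> ?thesis"
    then have "u \<in> Bad" using that by (auto simp: Bad_def)
    then have "T \<le> u" unfolding T_def using bdd by (rule cInf_lower)
    with that show False by simp
  qed
  \<comment> \<open>The strip is closed, so by continuity its bounds still hold at the infimum
    \<open>T\<close>. A robot whose start time is \<open>T\<close> itself is covered by
    \<open>init\<close>.\<close>
  have good: "b \<le> q j u \<and> q j u \<le> h" if "j < N" "\<tau> j \<le> u" "u \<le> T" for j u
  proof (cases "\<tau> j < u \<and> u = T")
    case True
    then have cl: "closure {\<tau> j..<u} = {\<tau> j..u}" by simp
    have c: "continuous_on (closure {\<tau> j..<u}) (q j)" using cl q_cont \<tau> that by simp
    have u: "u \<in> closure {\<tau> j..<u}" using cl True by simp
    have "b \<le> q j u" by (rule continuous_ge_on_closure[OF c u]) (use before True that in auto)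
    moreover have "q j u \<le> h" 
      by (rule continuous_le_on_closure[OF c u]) (use before True that in auto)
    ultimately show ?thesis ..
  next
    case False
    then show ?thesis using before[of j u] init[of j] that by (cases "u = \<tau> j") auto
  qed
  obtain \<eta> where \<eta>: "0 < \<eta>" "\<And>j s. j < N \<Longrightarrow> T < s \<Longrightarrow> s < T + \<eta> \<Longrightarrow> \<not> fires p j s"
    using no_fires_after[of T] by blast
  obtain t' where "t' \<in> Bad" and t': "t' < T + \<eta>"
    using \<eta>(1) cInf_less_iff[OF ne bdd, of "T + \<eta>"] by (auto simp: T_def)
  then obtain i' where i': "i' < N" "\<tau> i' \<le> t'" "\<not> (b \<le> q i' t' \<and> q i' t' \<le> h)"
    by (auto simp: Bad_def)
  have "T < t'" using good[OF i'(1,2)] i'(3) by linarith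
  define a where "a = max T (\<tau> i')"
  have a: "a \<le> t'" "0 \<le> a" "T \<le> a" "\<tau> i' \<le> a"
    using \<open>T < t'\<close> i' \<tau>[of i'] by (auto simp: a_def)
  have qa: "b \<le> q i' a \<and> q i' a \<le> h"
    using good[of i' T] init[of i'] i' by (auto simp: a_def max_def)
  have rate: "(w i' u < \<omega>0 \<longrightarrow> b \<le> q i' u) \<and> (\<omega>0 < w i' u \<longrightarrow> q i' u \<le> h)"
    if u: "a < u" "u < t'" for u
  proof (cases "w i' u = \<omega>0")
    case False
    then obtain s where s: "active i' s u" using rate_inactive[of i' u] i' u a by auto
    have "s \<le> T"
      using accepted_fires[OF active_accepted[OF s]] \<eta>(2)[of _ s] active_le[OF s] u t' by force
    then show ?thesis using step[OF i'(1) _ s] good u a by auto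
  qed simp
  have der: "(q i' has_real_derivative w i' u - \<omega>0) (at_right u)" if "a < u" for u
    using q_deriv[of i' u] i' a that by simp
  have c: "continuous_on {a..t'} (q i')" using q_cont i' a by simp
  have "b \<le> q i' t'"
    using right_derivative_barrier_ge[OF a(1) c der, of b] qa rate by force
  moreover have "q i' t' \<le> h"
    using right_derivative_barrier_le[OF a(1) c der, of h] qa rate by force
  ultimately show False using i' by simp
qed

end

section \<open>Executions with initial headings in an arc shorter than a half turn\<close>

locale pulse_coupled_arc = pulse_coupled +
  fixes lo hi :: real
  assumes init: "i < N \<Longrightarrow> lo \<le> p i 0 \<and> p i 0 \<le> hi"
    and arc_less_pi: "hi - lo < pi"
    and arc_refractory: "hi - lo \<le> 2 * pi - D"
    and connected: "strongly_connected N E"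
    and N_pos: "0 < N"
begin

text \<open>Trapping in the initial strip: up to the pulse all headings differ by less than
  \<open>pi\<close>, so the pulse aims at a heading that lies in the strip itself.\<close>

lemma q_bounds: "i < N \<Longrightarrow> 0 \<le> t \<Longrightarrow> lo \<le> q i t \<and> q i t \<le> hi"
proof (rule trapping[where \<tau> = "\<lambda>_. 0"])
  show "(w i t < \<omega>0 \<longrightarrow> lo \<le> q i t) \<and> (\<omega>0 < w i t \<longrightarrow> q i t \<le> hi)"
    if "i < N" "0 \<le> t" "active i s t"
      and IH: "\<And>j u. j < N \<Longrightarrow> 0 \<le> u \<Longrightarrow> u \<le> s \<Longrightarrow> lo \<le> q j u \<and> q j u \<le> hi" for i s t
  proof -
    have s: "0 \<le> s" using active_pos[OF that(3)] by simp
    have "\<bar>q i s - q j s\<bar> < pi" if "j < N" for j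
      using IH[OF that s] IH[OF \<open>i < N\<close> s] arc_less_pi by (smt (verit))
    from active_target[OF \<open>i < N\<close> \<open>active i s t\<close> this] show ?thesis
      using IH[OF _ s order_refl] \<omega>max_pos by (smt (verit))
  qed
qed (use init in \<open>auto simp: q_def\<close>)

lemma target:
  assumes "i < N" "active i s t"
  obtains j k where "j < N" "fires p j s" "p j s = 2 * pi * of_int k"
    "w i t = \<omega>0 - \<omega>max \<and> q j s < q i t \<or> w i t = \<omega>0 + \<omega>max \<and> q i t < q j s"
proof (rule active_target[OF assms])
  have s: "0 \<le> s" using active_pos[OF assms(2)] by simp
  show "\<bar>q i s - q j s\<bar> < pi" if "j < N" for j
    using q_bounds[OF that s] q_bounds[OF \<open>i < N\<close> s] arc_less_pi by (smt (verit))
qed (use that in blast)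

subsection \<open>Firing times and firing headings\<close>

text \<open>The level \<open>2 * pi * n\<close> is above every initial phase, so each robot reaches
  it from below. The index \<open>n\<close> numbers the rounds.\<close>

definition regular :: "nat \<Rightarrow> bool" where "regular n \<longleftrightarrow> hi < 2 * pi * real n"

text \<open>For regular rounds the choice is determined, by \<open>ex_fires\<close> and
  \<open>fires_unique\<close>.\<close>

definition fire_time :: "nat \<Rightarrow> nat \<Rightarrow> real" where
  "fire_time i n = (SOME s. fires p i s \<and> p i s = 2 * pi * real n)"

definition fire_heading :: "nat \<Rightarrow> nat \<Rightarrow> real" where "fire_heading i n = q i (fire_time i n)"

lemma regular_mono: "regular m \<Longrightarrow> m \<le> n \<Longrightarrow> regular n"
  unfolding regular_def by (erule less_le_trans) simp

text \<open>The phase is at least \<open>lo + \<omega>0 * t\<close>, so it reaches the level by the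
  time \<open>T\<close>; the first time on the level is a firing.\<close>

lemma ex_fires:
  assumes "i < N" "regular n"
  shows "\<exists>s. fires p i s \<and> p i s = 2 * pi * real n"
proof -
  let ?l = "2 * pi * real n"
  define T where "T = max 0 ((?l - lo) / \<omega>0)"
  have p0: "p i 0 < ?l" using init[OF \<open>i < N\<close>] assms(2) by (simp add: regular_def)
  have "?l - lo \<le> \<omega>0 * T" using \<omega>0_pos by (simp add: T_def max_def field_simps)
  then have pT: "?l \<le> p i T" using q_bounds[OF \<open>i < N\<close>, of T] by (simp add: q_def T_def)
  have T0: "0 \<le> T" by (simp add: T_def)
  define S where "S = {u \<in> {0..T}. ?l \<le> p i u}"
  have "closed S" unfolding S_def
    by (intro continuous_on_closed_Collect_le continuous_on_const p_cont closed_atLeastAtMost)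
       (use assms in auto)
  have TS: "T \<in> S" using pT T0 by (simp add: S_def)
  have bdd: "bdd_below S" by (rule bdd_belowI[of _ 0]) (simp add: S_def)
  define s where "s = Inf S"
  have sS: "s \<in> S"
    unfolding s_def using closed_contains_Inf[OF _ bdd \<open>closed S\<close>] TS by blast
  then have s: "0 \<le> s" "s \<le> T" "?l \<le> p i s" by (auto simp: S_def)
  have before: "p i u < ?l" if "0 \<le> u" "u < s" for u
  proof (rule ccontr)
    assume "\<not> p i u < ?l"
    then have "u \<in> S" using that s by (auto simp: S_def)
    then have "s \<le> u" unfolding s_def using bdd cInf_lower by blast
    with that show False by simp
  qed
  have "s \<noteq> 0" using s p0 by auto
  with s have spos: "0 < s" by simp
  have cont: "continuous_on (closure {0..<s}) (p i)" using p_cont assms spos by simp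
  have "p i s \<le> ?l"
    by (rule continuous_le_on_closure[OF cont]) (use spos before in \<open>auto intro: less_imp_le\<close>)
  with s have eq: "p i s = ?l" by simp
  have "fires p i s" unfolding fires_def
  proof (intro conjI spos)
    show "\<exists>k::int. p i s = 2 * pi * of_int k" using eq by (intro exI[of _ "int n"]) simp
    show "\<exists>\<epsilon>>0. \<forall>u. s - \<epsilon> < u \<and> u < s \<longrightarrow> p i u < p i s"
      using spos before eq by (intro exI[of _ s]) auto
  qed
  with eq show ?thesis by blast
qed

lemma fire_time_fires: "i < N \<Longrightarrow> regular n \<Longrightarrow> fires p i (fire_time i n)"
  and p_fire_time: "i < N \<Longrightarrow> regular n \<Longrightarrow> p i (fire_time i n) = 2 * pi * real n"
  unfolding fire_time_def using someI_ex[OF ex_fires] by blast+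

lemma fire_time_pos: "i < N \<Longrightarrow> regular n \<Longrightarrow> 0 < fire_time i n"
  using fire_time_fires fires_pos by blast

lemma p_before_fire_time: "i < N \<Longrightarrow> regular n \<Longrightarrow> 0 \<le> u \<Longrightarrow> u < fire_time i n \<Longrightarrow> p i u < 2 * pi * real n"
  using fires_first[OF _ fire_time_fires, of i n "int n" u] p_fire_time by simp

lemma p_after_fire_time: "i < N \<Longrightarrow> regular n \<Longrightarrow> fire_time i n \<le> u \<Longrightarrow> 2 * pi * real n \<le> p i u"
  using stays_above_level[of i "fire_time i n" u "int n"] p_fire_time fire_time_pos by fastforce

lemma fire_time_unique:
  "j < N \<Longrightarrow> regular n \<Longrightarrow> fires p j s \<Longrightarrow> p j s = 2 * pi * real n \<Longrightarrow> s = fire_time j n"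
  using fires_unique fire_time_fires p_fire_time by metis

text \<open>Within a round, firing earlier is thus the same as firing with a larger heading. This
  translates between the order of times and the order of headings.\<close>

lemma fire_time_eq: "i < N \<Longrightarrow> regular n \<Longrightarrow> \<omega>0 * fire_time i n = 2 * pi * real n - fire_heading i n"
  using p_fire_time by (simp add: fire_heading_def q_def)

lemma fire_heading_bounds: "i < N \<Longrightarrow> regular n \<Longrightarrow> lo \<le> fire_heading i n \<and> fire_heading i n \<le> hi"
  unfolding fire_heading_def using q_bounds fire_time_pos by fastforce

lemma fire_time_mono:
  assumes "i < N" "regular m" "m \<le> n"
  shows "fire_time i m \<le> fire_time i n"
proof (rule ccontr)
  assume "\<not> fire_time i m \<le> fire_time i n"
  then have "p i (fire_time i n) < 2 * pi * real m"
    using p_before_fire_time[OF assms(1,2), of "fire_time i n"] fire_time_pos[OF assms(1) regular_mono[OF assms(2,3)]]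
    by simp
  then show False using p_fire_time[OF assms(1) regular_mono[OF assms(2,3)]] assms(3) by simp
qed

text \<open>A full turn less a spread of headings below \<open>pi\<close>. In particular consecutive
  rounds do not interleave.\<close>

lemma fire_time_Suc_diff:
  assumes "i < N" "j < N" "regular n"
  shows "pi < \<omega>0 * (fire_time i (Suc n) - fire_time j n)"
proof -
  have "regular (Suc n)" using assms regular_mono by simp
  then have "\<omega>0 * (fire_time i (Suc n) - fire_time j n) = 2 * pi - (fire_heading i (Suc n) - fire_heading j n)"
    using fire_time_eq assms by (simp add: right_diff_distrib algebra_simps)
  then show ?thesis
    using fire_heading_bounds[OF assms(1) \<open>regular (Suc n)\<close>] fire_heading_bounds[OF assms(2,3)] arc_less_pi
    by (smt (verit))
qed

lemma firing_times_unbounded: "\<exists>n0. \<forall>n\<ge>n0. regular n \<and> (\<forall>i<N. T \<le> fire_time i n)"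
proof -
  obtain n0 :: nat where n0: "(max 0 (\<omega>0 * T) + \<bar>hi\<bar>) / (2 * pi) < real n0"
    using reals_Archimedean2 by blast
  then have n0: "max 0 (\<omega>0 * T) + \<bar>hi\<bar> < 2 * pi * real n0" by (simp add: field_simps)
  have "regular n \<and> (\<forall>i<N. T \<le> fire_time i n)" if "n0 \<le> n" for n
  proof -
    have "2 * pi * real n0 \<le> 2 * pi * real n" using that by simp
    with n0 have n: "max 0 (\<omega>0 * T) + \<bar>hi\<bar> < 2 * pi * real n" by linarith
    then have r: "regular n" by (simp add: regular_def)
    have "T \<le> fire_time i n" if "i < N" for i
    proof -
      have "\<omega>0 * T \<le> \<omega>0 * fire_time i n"
        using fire_time_eq[OF that r] fire_heading_bounds[OF that r] n by linarith
      then show ?thesis using \<omega>0_pos by simp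
    qed
    with r show ?thesis by blast
  qed
  then show ?thesis by blast
qed

section \<open>The gain of a lagging robot and its propagation along paths\<close>

definition c :: real where "c = min \<alpha> (\<omega>max / (\<omega>0 + \<omega>max))"

lemma c_pos: "0 < c" and c_le_1: "c \<le> 1" and c_le_\<alpha>: "c \<le> \<alpha>"
  and c_rate: "c * (\<omega>0 + \<omega>max) \<le> \<omega>max"
proof -
  have "c \<le> \<omega>max / (\<omega>0 + \<omega>max)" by (simp add: c_def)
  then show "c * (\<omega>0 + \<omega>max) \<le> \<omega>max" using \<omega>0_pos \<omega>max_pos by (simp add: field_simps)
qed (use \<alpha>_pos \<alpha>_le_1 \<omega>0_pos \<omega>max_pos in \<open>auto simp: c_def\<close>)

text \<open>Here \<open>g\<close> stands for a heading gain during a time \<open>v\<close> of full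
  acceleration, and \<open>g + \<omega>0 * v\<close> for the phase advance in that time. Their ratio
  is least when \<open>g = \<omega>max * v\<close>.\<close>

lemma c_gain:
  assumes "0 \<le> v" "\<omega>max * v \<le> g"
  shows "c * (g + \<omega>0 * v) \<le> g"
proof -
  have "0 \<le> g" using assms \<omega>max_pos by (smt (verit) mult_nonneg_nonneg)
  have "\<omega>max * (c * (g + \<omega>0 * v)) = c * (\<omega>max * g + \<omega>0 * (\<omega>max * v))" by (simp add: algebra_simps)
  also have "\<dots> \<le> c * (\<omega>max * g + \<omega>0 * g)"
    using assms \<omega>0_pos c_pos by (intro mult_left_mono add_left_mono) auto
  also have "\<dots> = c * (\<omega>0 + \<omega>max) * g" by (simp add: algebra_simps)
  also have "\<dots> \<le> \<omega>max * g" using c_rate \<open>0 \<le> g\<close> by (rule mult_right_mono)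
  finally show ?thesis using \<omega>max_pos by simp
qed

text \<open>Between the pulse of \<^term>\<open>j\<close> and its own firing, robot \<^term>\<open>i\<close> lags behind, so it accepts
  and moves forward on every pulse.  It either speeds up until it fires, gaining the share
  \<open>\<omega>max / (\<omega>0 + \<omega>max)\<close> of its lag, or some adjustment is completed; before the first completion it
  has been speeding up throughout, and the completed one closes the share \<open>\<alpha>\<close> of the rest.\<close>
lemma lagging_robot_gains:
  assumes ij: "i < N" "j < N" and "E j i" and reg: "regular n" and later: "fire_time j n < fire_time i n"
  defines "s \<equiv> fire_time j n"
  shows "q i s + c * (fire_heading j n - q i s) \<le> fire_heading i n"
proof -
  define r where "r = fire_time i n"
  define l where "l = 2 * pi * real n"
  define x where "x = l - p i s"
  have s: "0 < s" "s < r" using fire_time_pos ij reg later by (auto simp: s_def r_def)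
  have pr: "p i r = l" using p_fire_time ij reg by (simp add: r_def l_def)
  have pjs: "p j s = l" using p_fire_time ij reg by (simp add: s_def l_def)
  have x: "x = fire_heading j n - q i s" using pjs by (simp add: x_def fire_heading_def q_def s_def)
  have range: "l - pi < p i t" "p i t < l" if "s \<le> t" "t < r" for t
  proof -
    show "p i t < l" using p_before_fire_time[OF ij(1) reg, of t] that s by (simp add: l_def r_def)
    have "l \<le> p j t" using p_after_fire_time[OF ij(2) reg, of t] that by (simp add: l_def s_def)
    moreover have "q j t - q i t < pi"
      using q_bounds[OF ij(1), of t] q_bounds[OF ij(2), of t] arc_less_pi s that by (smt (verit))
    ultimately show "l - pi < p i t" by (simp add: q_def)
  qed
  have adj: "adj \<alpha> p i a = \<alpha> * (l - p i a)" if "s \<le> a" "a < r" for a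
    using adj_toward[of i a "int n"] range[OF that] by (simp add: l_def)
  \<comment> \<open>The lag \<open>x\<close> is at most \<open>hi - lo\<close>, so the phase
    \<open>2 * pi - x\<close> of the receiver is at least \<open>D\<close>: the pulse falls outside
    the refractory period.\<close>
  have sA: "s \<in> A i"
  proof -
    have "x \<le> hi - lo" using x fire_heading_bounds[OF ij(2) reg] q_bounds[OF ij(1), of s] s by simp
    moreover have "wrap (p i s) = p i s - 2 * pi * of_int (int n - 1)"
      using range[of s] s pi_gt_zero by (intro wrap_eqI) (auto simp: l_def algebra_simps)
    ultimately have "D \<le> wrap (p i s)"
      using arc_refractory by (simp add: x_def l_def algebra_simps)
    then show ?thesis
      using ij \<open>E j i\<close> fire_time_fires[OF ij(2) reg] by (auto simp: accepted_def s_def)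
  qed
  have rate: "w i t = \<omega>0 + \<omega>max" if t: "s \<le> t" "t < r" and act: "active i a t" for t a
  proof -
    have a: "s \<le> a" "a \<le> t" using act sA t by (auto simp: active_def)
    then have "0 < adj \<alpha> p i a" using adj range(2) \<alpha>_pos t by simp
    then show ?thesis using rate_active[OF ij(1) _ act] s t by simp
  qed
  have rates: "w i t = \<omega>0 + \<omega>max \<or> w i t = \<omega>0 \<and> (\<nexists>a. active i a t)" if "s \<le> t" "t < r" for t
    using rate_cases[OF ij(1), of t] rate[OF that] s that by fastforce
  have rate_ge: "\<omega>0 \<le> w i t" if "s \<le> t" "t < r" for t
    using rates[OF that] \<omega>max_pos by auto
  have rate_full: "\<omega>max \<le> w i t - \<omega>0" if "s \<le> t" "t < r" "w i t \<noteq> \<omega>0" for t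
    using rates[OF that(1,2)] that(3) by auto
  have der: "(q i has_real_derivative w i t - \<omega>0) (at_right t)" if "s \<le> t" for t
    using q_deriv ij s that by simp
  have cont: "continuous_on {a..b} (q i)" if "s \<le> a" for a b using q_cont ij s that by simp
  have mono: "q i a \<le> q i b" if "s \<le> a" "a \<le> b" "b \<le> r" for a b
  proof -
    have "0 * (b - a) \<le> q i b - q i a"
      by (rule right_derivative_ge[where g = "\<lambda>t. w i t - \<omega>0", OF that(2) cont[OF that(1)]])
         (use der rate_ge that in auto)
    then show ?thesis by simp
  qed
  have gain: "\<omega>max * (b - a) \<le> q i b - q i a"
    if "s \<le> a" "a \<le> b" "b \<le> r" "\<And>t. a < t \<Longrightarrow> t < b \<Longrightarrow> w i t \<noteq> \<omega>0" for a b
    by (rule right_derivative_ge[where g = "\<lambda>t. w i t - \<omega>0", OF that(2) cont[OF that(1)]])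
       (use der rate_full that in auto)
  have xpos: "0 < x" using range[of s] s by (simp add: x_def)
  have "c * x \<le> q i r - q i s"
  proof (cases "\<exists>t. s < t \<and> t < r \<and> w i t = \<omega>0")
    case False
    then have "\<omega>max * (r - s) \<le> q i r - q i s" using gain[of s r] s by auto
    moreover have "x = q i r - q i s + \<omega>0 * (r - s)" by (simp add: x_def q_def pr algebra_simps)
    ultimately show ?thesis using c_gain s by simp
  next
    case True
    define I where "I = {t. s \<le> t \<and> t < r \<and> w i t = \<omega>0}"
    have ne: "I \<noteq> {}" using True by (auto simp: I_def)
    have bdd: "bdd_below I" by (rule bdd_belowI[of _ s]) (simp add: I_def)
    define T where "T = Inf I"
    have "s \<le> T" unfolding T_def using ne by (intro cInf_greatest) (auto simp: I_def)
    obtain t1 where "t1 \<in> I" using ne by blast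
    then have "T < r" using cInf_lower[OF _ bdd, of t1] by (simp add: I_def T_def)
    have before: "w i t \<noteq> \<omega>0" if "s \<le> t" "t < T" for t
      using cInf_lower[OF _ bdd, of t] that \<open>T < r\<close> by (auto simp: T_def I_def)
    obtain \<eta> where \<eta>: "0 < \<eta>" "\<And>j s. j < N \<Longrightarrow> T < s \<Longrightarrow> s < T + \<eta> \<Longrightarrow> \<not> fires p j s"
      using no_fires_after[of T] by blast
    obtain a where a: "a \<in> A i" "s \<le> a" "a \<le> T" "\<And>a'. a' \<in> A i \<Longrightarrow> a' \<le> T \<Longrightarrow> a' \<le> a"
      using last_accepted[OF sA \<open>s \<le> T\<close>] by blast
    define y where "y = l - p i a"
    define d where "d = \<alpha> * y / \<omega>max"
    have "a < r" using a \<open>T < r\<close> by simp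
    have ypos: "0 < y" using range[OF \<open>s \<le> a\<close> \<open>a < r\<close>] by (simp add: y_def)
    have dpos: "0 < d" using ypos \<alpha>_pos \<omega>max_pos by (simp add: d_def)
    have absadj: "\<bar>adj \<alpha> p i a\<bar> / \<omega>max = d"
      using adj[OF \<open>s \<le> a\<close> \<open>a < r\<close>] ypos \<alpha>_pos by (simp add: d_def y_def abs_mult)
    \<comment> \<open>Otherwise the last pulse \<open>a\<close> would still be active at points of
      \<open>I\<close> just after \<open>T\<close>, where the rate is
      \<open>\<omega>0\<close>.\<close>
    have "a + d \<le> T"
    proof (rule ccontr)
      assume "\<not> a + d \<le> T"
      then have "T < min (T + \<eta>) (a + d)" using \<eta>(1) by simp
      then obtain t where t: "t \<in> I" "t < T + \<eta>" "t < a + d"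
        using cInf_less_iff[OF ne bdd, of "min (T + \<eta>) (a + d)"] by (auto simp flip: T_def)
      have "T \<le> t" unfolding T_def using t(1) bdd by (rule cInf_lower)
      have "a' \<le> a" if "a' \<in> A i" "a' \<le> t" for a'
      proof (rule a(4)[OF that(1)])
        show "a' \<le> T" using accepted_fires[OF that(1)] \<eta>(2)[of _ a'] that(2) t(2) by force
      qed
      then have act: "active i a t"
        unfolding active_def absadj using a t \<open>T \<le> t\<close> by auto
      then show False using rate[OF _ _ act] t(1) \<omega>max_pos by (simp add: I_def)
    qed
    define g where "g = q i a - q i s"
    have g: "\<omega>max * (a - s) \<le> g"
      unfolding g_def using gain[of s a] before a \<open>T < r\<close> by auto
    have "\<omega>max * (a + d - a) \<le> q i (a + d) - q i a"
      by (rule gain) (use before a \<open>T < r\<close> \<open>a + d \<le> T\<close> dpos in auto)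
    then have "\<alpha> * y \<le> q i (a + d) - q i a" using \<omega>max_pos by (simp add: d_def)
    moreover have "q i (a + d) \<le> q i r" by (rule mono) (use a \<open>T < r\<close> \<open>a + d \<le> T\<close> dpos in auto)
    moreover have "c * y \<le> \<alpha> * y" using c_le_\<alpha> ypos by (intro mult_right_mono) auto
    \<comment> \<open>The lag at \<open>s\<close> is the lag \<open>y\<close> left at the pulse
      \<open>a\<close> plus the phase advance made in between; each summand yields its own
      share.\<close>
    moreover have "x = y + (g + \<omega>0 * (a - s))" by (simp add: x_def y_def g_def q_def algebra_simps)
    moreover have "c * (g + \<omega>0 * (a - s)) \<le> g"
      using c_gain g a by simp
    ultimately show ?thesis by (simp add: g_def distrib_left)
  qed
  then show ?thesis by (simp add: x fire_heading_def r_def)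
qed

text \<open>If \<open>i\<close> fires after \<open>j\<close>, it gains as a lagging robot; if not,
  its firing heading is already at least that of \<open>j\<close>. Measuring both from a common
  lower bound \<open>m\<close> lets the estimate be iterated.\<close>

lemma firing_push:
  assumes "i < N" "j < N" "E j i" "regular n" "m \<le> q i (fire_time j n)" "m \<le> fire_heading j n"
  shows "c * (fire_heading j n - m) \<le> fire_heading i n - m"
proof (cases "fire_time j n < fire_time i n")
  case True
  have "c * (q i (fire_time j n) - m) \<le> 1 * (q i (fire_time j n) - m)"
    using assms c_le_1 by (intro mult_right_mono) auto
  with lagging_robot_gains[OF assms(1-4) True] show ?thesis by (simp add: algebra_simps)
next
  case False
  then have "\<omega>0 * fire_time i n \<le> \<omega>0 * fire_time j n" using \<omega>0_pos by simp
  then have "fire_heading j n \<le> fire_heading i n" using fire_time_eq assms by (simp add: algebra_simps)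
  moreover have "c * (fire_heading j n - m) \<le> 1 * (fire_heading j n - m)"
    using assms c_le_1 by (intro mult_right_mono) auto
  ultimately show ?thesis by simp
qed

abbreviation edge :: "nat \<Rightarrow> nat \<Rightarrow> bool" where "edge \<equiv> \<lambda>a b. a < N \<and> b < N \<and> E a b"

lemma firing_push_path:
  assumes "regular n" and m: "\<And>i j. i < N \<Longrightarrow> j < N \<Longrightarrow> m \<le> q i (fire_time j n)"
  shows "(edge ^^ k) j i \<Longrightarrow> i < N \<Longrightarrow> j < N \<Longrightarrow> c ^ k * (fire_heading j n - m) \<le> fire_heading i n - m"
proof (induction k arbitrary: i)
  case (Suc k)
  from Suc.prems(1) obtain l where l: "(edge ^^ k) j l" "edge l i" by auto
  then have "c ^ k * (fire_heading j n - m) \<le> fire_heading l n - m" using Suc.IH Suc.prems by blast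
  then have "c * (c ^ k * (fire_heading j n - m)) \<le> c * (fire_heading l n - m)"
    using c_pos by (intro mult_left_mono) auto
  also have "\<dots> \<le> fire_heading i n - m"
    using firing_push[of i l n m] l m[of i l] m[of l l] assms(1) by (simp add: fire_heading_def)
  finally show ?case by (simp add: mult.assoc)
qed simp

text \<open>There are finitely many pairs of robots, so one exponent \<open>K\<close> bounds the
  lengths of connecting paths, and \<open>C = c ^ K\<close> serves for all pairs and rounds.\<close>

lemma firing_push_uniform:
  obtains C where "0 < C" "C \<le> 1"
    "\<And>n m i j. regular n \<Longrightarrow> (\<And>i j. i < N \<Longrightarrow> j < N \<Longrightarrow> m \<le> q i (fire_time j n)) \<Longrightarrow>
      i < N \<Longrightarrow> j < N \<Longrightarrow> C * (fire_heading j n - m) \<le> fire_heading i n - m"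
proof -
  have ex: "\<exists>k. (edge ^^ k) j i" if "j < N" "i < N" for j i
  proof -
    have "edge\<^sup>*\<^sup>* j i" using connected that unfolding strongly_connected_def by simp
    then show ?thesis by (rule rtranclp_imp_relpowp)
  qed
  define \<kappa> where "\<kappa> j i = (SOME k. (edge ^^ k) j i)" for j i
  have \<kappa>: "(edge ^^ \<kappa> j i) j i" if "j < N" "i < N" for j i
    unfolding \<kappa>_def by (rule someI_ex[OF ex[OF that]])
  define K where "K = Max ((\<lambda>(j, i). \<kappa> j i) ` ({..<N} \<times> {..<N}))"
  have K: "\<kappa> j i \<le> K" if "j < N" "i < N" for j i
    unfolding K_def using that by (intro Max_ge) auto
  show thesis
  proof (rule that[of "c ^ K"])
    fix n m i j
    assume reg: "regular n" and m: "\<And>i j. i < N \<Longrightarrow> j < N \<Longrightarrow> m \<le> q i (fire_time j n)"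
      and ij: "i < N" "j < N"
    have "c ^ K * (fire_heading j n - m) \<le> c ^ \<kappa> j i * (fire_heading j n - m)"
      using m[OF ij(2,2)] c_pos c_le_1 K[OF ij(2,1)]
      by (intro mult_right_mono power_decreasing) (auto simp: fire_heading_def)
    also have "\<dots> \<le> fire_heading i n - m" using firing_push_path[OF reg m \<kappa>] ij by blast
    finally show "c ^ K * (fire_heading j n - m) \<le> fire_heading i n - m" .
  qed (use c_pos c_le_1 in \<open>auto intro: power_le_one\<close>)
qed

section \<open>Late times\<close>

lemma late_target:
  obtains T where "0 \<le> T" "\<And>i s t. i < N \<Longrightarrow> T \<le> t \<Longrightarrow> active i s t \<Longrightarrow> \<exists>j<N. \<exists>n\<ge>n0.
     w i t = \<omega>0 - \<omega>max \<and> fire_heading j n < q i t \<or> w i t = \<omega>0 + \<omega>max \<and> q i t < fire_heading j n"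
proof -
  obtain n1 where n1: "n0 \<le> n1" "regular n1"
    using firing_times_unbounded[of 0] by (meson linear order_refl)
  define T where "T = Max (insert 0 ((\<lambda>j. fire_time j n1) ` {..<N}))"
  have T: "0 \<le> T" "\<And>j. j < N \<Longrightarrow> fire_time j n1 \<le> T" unfolding T_def by (auto intro: Max_ge)
  show thesis
  \<comment> \<open>After this delay every active pulse was sent later than \<open>T\<close>, when
    all robots had fired in round \<open>n1\<close>; so it belongs to a round from \<open>n0\<close>
    on.\<close>
  proof (rule that[of "T + pi / \<omega>max"])
    show "0 \<le> T + pi / \<omega>max" using T \<omega>max_pos by simp
    fix i s t assume i: "i < N" "T + pi / \<omega>max \<le> t" "active i s t"
    obtain j k where j: "j < N" "fires p j s" "p j s = 2 * pi * of_int k"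
      "w i t = \<omega>0 - \<omega>max \<and> q j s < q i t \<or> w i t = \<omega>0 + \<omega>max \<and> q i t < q j s"
      using target[OF i(1,3)] .
    have "T < s" using active_recent[OF i(3)] i(2) by simp
    then have "2 * pi * real n1 \<le> p j s" using p_after_fire_time[OF j(1) n1(2), of s] T(2)[OF j(1)] by simp
    then have "real n1 \<le> of_int k" using j(3) by simp
    then have "int n1 \<le> k" by linarith
    then obtain n where n: "k = int n" "n1 \<le> n" using zero_le_imp_eq_int[of k] by force
    then have "s = fire_time j n"
      using fire_time_unique[OF j(1) regular_mono[OF n1(2) n(2)] j(2)] j(3) by simp
    then show "\<exists>j<N. \<exists>n\<ge>n0.
        w i t = \<omega>0 - \<omega>max \<and> fire_heading j n < q i t \<or> w i t = \<omega>0 + \<omega>max \<and> q i t < fire_heading j n"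
      using j n n1 unfolding fire_heading_def by (meson order_trans)
  qed
qed

text \<open>A robot is in the strip at its firing in round \<open>n2\<close>. From then on its
  adjustments aim at firing headings of late rounds, which lie in the strip, so it cannot
  leave.\<close>

lemma q_eventually_between:
  assumes "\<And>n j. n0 \<le> n \<Longrightarrow> j < N \<Longrightarrow> b \<le> fire_heading j n \<and> fire_heading j n \<le> h"
  obtains T where "0 \<le> T"
    "\<And>i t. i < N \<Longrightarrow> T \<le> t \<Longrightarrow> b \<le> q i t \<and> q i t \<le> h"
proof -
  obtain T where T: "0 \<le> T" "\<And>i s t. i < N \<Longrightarrow> T \<le> t \<Longrightarrow> active i s t \<Longrightarrow> \<exists>j<N. \<exists>n\<ge>n0.
     w i t = \<omega>0 - \<omega>max \<and> fire_heading j n < q i t \<or> w i t = \<omega>0 + \<omega>max \<and> q i t < fire_heading j n"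
    using late_target[of n0] by blast
  obtain n1 where n1: "\<And>n. n1 \<le> n \<Longrightarrow> regular n \<and> (\<forall>i<N. T \<le> fire_time i n)"
    using firing_times_unbounded by blast
  define n2 where "n2 = max n0 n1"
  have n2: "n0 \<le> n2" "regular n2" "\<And>i. i < N \<Longrightarrow> T \<le> fire_time i n2" using n1[of n2] by (auto simp: n2_def)
  define T' where "T' = Max (insert 0 ((\<lambda>j. fire_time j n2) ` {..<N}))"
  have T': "0 \<le> T'" "\<And>j. j < N \<Longrightarrow> fire_time j n2 \<le> T'" unfolding T'_def by (auto intro: Max_ge)
  have "b \<le> q i t \<and> q i t \<le> h" if "i < N" "T' \<le> t" for i t
  proof -
    define a where "a = fire_time i n2"
    have a: "0 < a" "T \<le> a" "a \<le> t" using fire_time_pos n2 T'(2)[OF that(1)] that by (auto simp: a_def)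
    have qa: "b \<le> q i a" "q i a \<le> h" using assms[OF n2(1) that(1)] by (auto simp: fire_heading_def a_def)
    have c: "continuous_on {a..t} (q i)" using q_cont that a by simp
    have der: "(q i has_real_derivative w i u - \<omega>0) (at_right u)" if "a < u" for u
      using q_deriv[of i u] \<open>i < N\<close> a that by simp
    have rate: "(w i u < \<omega>0 \<longrightarrow> b \<le> q i u) \<and> (\<omega>0 < w i u \<longrightarrow> q i u \<le> h)" if u: "a < u" for u
    proof (cases "w i u = \<omega>0")
      case False
      then obtain s where "active i s u" using rate_inactive[of i u] \<open>i < N\<close> u a by auto
      then obtain j n where "j < N" "n0 \<le> n"
        "w i u = \<omega>0 - \<omega>max \<and> fire_heading j n < q i u \<or> w i u = \<omega>0 + \<omega>max \<and> q i u < fire_heading j n"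
        using T(2)[of i u s] \<open>i < N\<close> u a by auto
      then show ?thesis using assms[of n j] \<omega>max_pos by auto
    qed simp
    have "b \<le> q i t"
      using right_derivative_barrier_ge[OF a(3) c der qa(1)] rate by force
    moreover have "q i t \<le> h"
      using right_derivative_barrier_le[OF a(3) c der qa(2)] rate by force
    ultimately show ?thesis ..
  qed
  then show thesis using that T' by blast
qed

text \<open>Adjustments that are still pending at firing \<open>n + 1\<close> and aim below \<^term>\<open>b\<close> would have to
  cover more than \<^term>\<open>u - l\<close>, since they have been active for about a full period.\<close>
lemma no_return:
  assumes low: "\<And>i t. i < N \<Longrightarrow> T \<le> t \<Longrightarrow> l \<le> q i t" and "0 \<le> T"
    and reg: "regular n" and late: "\<And>i. i < N \<Longrightarrow> T + pi / \<omega>max \<le> fire_time i n"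
    and up: "\<And>i. i < N \<Longrightarrow> fire_heading i n \<le> u"
    and b: "\<And>i. i < N \<Longrightarrow> b \<le> fire_heading i (Suc n)"
    and small: "(u - l) * (\<omega>0 + \<omega>max) < \<omega>max * pi"
    and "i < N" "fire_time i (Suc n) \<le> t"
  shows "b \<le> q i t"
proof -
  have reg': "regular (Suc n)" using reg regular_mono by simp
  have "b \<le> q i t \<and> q i t \<le> hi"
  proof (rule trapping[where \<tau> = "\<lambda>i. fire_time i (Suc n)"])
    show "0 \<le> fire_time i (Suc n)" if "i < N" for i using fire_time_pos[OF that reg'] by simp
    show "b \<le> q i (fire_time i (Suc n)) \<and> q i (fire_time i (Suc n)) \<le> hi" if "i < N" for i
      using b[OF that] fire_heading_bounds[OF that reg'] by (simp add: fire_heading_def)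
    fix i s t
    assume i: "i < N" and t: "fire_time i (Suc n) \<le> t" and act: "active i s t"
      and IH: "\<And>j u. j < N \<Longrightarrow> fire_time j (Suc n) \<le> u \<Longrightarrow> u \<le> s \<Longrightarrow> b \<le> q j u \<and> q j u \<le> hi"
    have t_pos: "0 \<le> t" using fire_time_pos[OF i reg'] t by simp
    have "b \<le> q i t" if neg: "w i t < \<omega>0"
    proof -
      obtain j k where j: "j < N" "fires p j s" "p j s = 2 * pi * of_int k"
        and "w i t = \<omega>0 - \<omega>max \<and> q j s < q i t \<or> w i t = \<omega>0 + \<omega>max \<and> q i t < q j s"
        using target[OF i act] .
      then have w: "w i t = \<omega>0 - \<omega>max" and tgt: "q j s < q i t" using neg \<omega>max_pos by auto
      have s: "0 < s" "s \<le> t" using active_pos active_le act by auto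
      show ?thesis
      \<comment> \<open>A pulse from round \<open>n + 1\<close> or later has its target above
        \<open>b\<close> by the induction hypothesis. Any other pulse dates from round
        \<open>n\<close> or before, because the sender does not fire between its two consecutive
        firings.\<close>
      proof (cases "fire_time j (Suc n) \<le> s")
        case True
        then show ?thesis using IH[OF j(1) True] tgt by simp
      next
        case False
        have "s \<le> fire_time j n"
        proof (rule ccontr)
          assume "\<not> s \<le> fire_time j n"
          then have "p j (fire_time j n) < 2 * pi * of_int k"
            using fires_first[OF j, of "fire_time j n"] fire_time_pos[OF j(1) reg] by simp
          then have "real_of_int (int n) < of_int k" using p_fire_time[OF j(1) reg] by simp
          then have "int (Suc n) \<le> k" unfolding of_int_less_iff by simp
          then have "real_of_int (int (Suc n)) \<le> of_int k" by (simp only: of_int_le_iff)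
          then have "real (Suc n) \<le> of_int k" by simp
          then have "2 * pi * real (Suc n) \<le> p j s" using j(3) by simp
          then show False using p_before_fire_time[OF j(1) reg', of s] False s by simp
        qed
        \<comment> \<open>From \<open>a\<close> on the adjustment acts at full speed, and at
          \<open>a\<close> the heading is still controlled by its value at firing
          \<open>n\<close>.\<close>
        define a where "a = max s (fire_time i n)"
        have ni: "T \<le> fire_time i n" "T \<le> fire_time j n" using late[OF i] late[OF j(1)] \<omega>max_pos pi_gt_zero
          by (smt (verit) divide_pos_pos)+
        have "fire_time i n \<le> fire_time i (Suc n)" using fire_time_mono[OF i reg] by simp
        then have a: "0 \<le> a" "s \<le> a" "a \<le> t" "fire_time i n \<le> a"
          using s t by (auto simp: a_def)
        have "T < s" using active_recent[OF act] late[OF i] t \<open>fire_time i n \<le> fire_time i (Suc n)\<close> by simp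
        then have "l \<le> q j s" using low[OF j(1)] by simp
        have fj: "l \<le> fire_heading j n" using low[OF j(1) ni(2)] by (simp add: fire_heading_def)
        have "sgn (adj \<alpha> p i s) * \<omega>max = - \<omega>max"
          using rate_active[OF i t_pos act] w by simp
        then have qt: "q i t = q i a - \<omega>max * (t - a)"
          using q_active[OF i act a(2,3)] q_active[OF i act s(2) order_refl]
          by (simp add: algebra_simps)
        have "q i a - q i (fire_time i n) \<le> \<omega>max * (a - fire_time i n)"
        proof (rule right_derivative_le[OF a(4)])
          show "continuous_on {fire_time i n..a} (q i)" using q_cont[OF i] fire_time_pos[OF i reg] by simp
          show "(q i has_real_derivative w i v - \<omega>0) (at_right v)" if "fire_time i n < v" for v
            using q_deriv[OF i] fire_time_pos[OF i reg] that by simp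
          show "w i v - \<omega>0 \<le> \<omega>max" if "fire_time i n < v" for v
            using rate_bound[OF i, of v] fire_time_pos[OF i reg] that by simp
        qed
        then have qa: "q i a \<le> u + \<omega>max * (a - fire_time i n)" using up[OF i] by (simp add: fire_heading_def)
        have "l \<le> u" using up[OF j(1)] fj by simp
        have "\<omega>0 * fire_time j n - \<omega>0 * fire_time i n \<le> u - l"
          using fire_time_eq[OF i reg] fire_time_eq[OF j(1) reg] up[OF i] fj by simp
        \<comment> \<open>Firing headings of round \<open>n\<close> lie between \<open>l\<close> and
          \<open>u\<close>, so the delay of \<open>a\<close> behind the firing of \<open>i\<close>
          is at most \<open>(u - l) / \<omega>0\<close>.\<close>
        then have d1: "\<omega>0 * (a - fire_time i n) \<le> u - l"
        proof (cases "s \<le> fire_time i n")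
          case False
          have "\<omega>0 * s \<le> \<omega>0 * fire_time j n" using \<open>s \<le> fire_time j n\<close> \<omega>0_pos by (intro mult_left_mono) auto
          with False \<open>\<omega>0 * fire_time j n - \<omega>0 * fire_time i n \<le> u - l\<close> show ?thesis
            unfolding a_def max_def right_diff_distrib by (simp only: if_False)
        qed (use \<open>l \<le> u\<close> in \<open>simp add: a_def\<close>)
        \<comment> \<open>As \<open>a\<close> is not later than some firing of round
          \<open>n\<close>, more than half a period separates it from firing
          \<open>n + 1\<close>.\<close>
        have "pi < \<omega>0 * (fire_time i (Suc n) - a)"
        proof -
          have "a \<le> fire_time j n \<or> a = fire_time i n" using \<open>s \<le> fire_time j n\<close> by (auto simp: a_def)
          then obtain j' where j': "j' < N" "a \<le> fire_time j' n" using i j(1) by auto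
          have "\<omega>0 * (fire_time i (Suc n) - fire_time j' n) \<le> \<omega>0 * (fire_time i (Suc n) - a)"
            using j' \<omega>0_pos by (intro mult_left_mono) auto
          with fire_time_Suc_diff[OF i j'(1) reg] show ?thesis by simp
        qed
        also have "\<dots> \<le> \<omega>0 * (t - a)" using t \<omega>0_pos by simp
        finally have d2: "pi < \<omega>0 * (t - a)" .
        have "l < u + \<omega>max * (a - fire_time i n) - \<omega>max * (t - a)"
          using \<open>l \<le> q j s\<close> tgt qt qa by simp
        then have "\<omega>0 * l < \<omega>0 * (u + \<omega>max * (a - fire_time i n) - \<omega>max * (t - a))"
          using \<omega>0_pos by simp
        also have "\<dots> = \<omega>0 * u + \<omega>max * (\<omega>0 * (a - fire_time i n)) - \<omega>max * (\<omega>0 * (t - a))"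
          by (simp add: algebra_simps)
        also have "\<dots> \<le> \<omega>0 * u + \<omega>max * (u - l) - \<omega>max * pi"
          using d1 d2 \<omega>0_pos \<omega>max_pos by (intro add_mono diff_mono mult_left_mono) auto
        finally have False using small by (simp add: algebra_simps)
        then show ?thesis ..
      qed
    qed
    then show "(w i t < \<omega>0 \<longrightarrow> b \<le> q i t) \<and> (\<omega>0 < w i t \<longrightarrow> q i t \<le> hi)"
      using q_bounds[OF i t_pos] by blast
  qed (use assms in auto)
  then show ?thesis ..
qed

subsection \<open>Convergence\<close>

text \<open>\<open>L\<close> is the supremum of the eventual lower bounds; it exists because firing
  headings stay between \<open>lo\<close> and \<open>hi\<close>.\<close>

lemma firing_headings_liminf:
  obtains L where "\<And>e. 0 < e \<Longrightarrow> \<exists>n0. \<forall>n\<ge>n0. \<forall>i<N. L - e \<le> fire_heading i n"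
    and "\<And>e m. 0 < e \<Longrightarrow> \<exists>n\<ge>m. \<exists>i<N. fire_heading i n < L + e"
proof -
  define S where "S = {y. \<exists>n0. \<forall>n\<ge>n0. \<forall>i<N. y \<le> fire_heading i n}"
  obtain r where r: "\<And>n. r \<le> n \<Longrightarrow> regular n" using firing_times_unbounded by blast
  have "lo \<in> S" using fire_heading_bounds r by (auto simp: S_def)
  then have ne: "S \<noteq> {}" by blast
  have bdd: "bdd_above S"
  proof (rule bdd_aboveI)
    fix y assume "y \<in> S"
    then obtain n0 where "\<forall>n\<ge>n0. \<forall>i<N. y \<le> fire_heading i n" by (auto simp: S_def)
    then have "y \<le> fire_heading 0 (max n0 r)" using N_pos by simp
    also have "\<dots> \<le> hi" using fire_heading_bounds N_pos r by simp
    finally show "y \<le> hi" .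
  qed
  show thesis
  proof (rule that[of "Sup S"])
    fix e :: real assume "0 < e"
    then obtain y where y: "y \<in> S" "Sup S - e < y"
      using less_cSup_iff[OF ne bdd, of "Sup S - e"] by auto
    then obtain n0 where "\<forall>n\<ge>n0. \<forall>i<N. y \<le> fire_heading i n" by (auto simp: S_def)
    with y(2) show "\<exists>n0. \<forall>n\<ge>n0. \<forall>i<N. Sup S - e \<le> fire_heading i n"
      by (intro exI[of _ n0]) fastforce
    have "Sup S + e \<notin> S" using cSup_upper[OF _ bdd, of "Sup S + e"] \<open>0 < e\<close> by auto
    then show "\<exists>n\<ge>m. \<exists>i<N. fire_heading i n < Sup S + e" for m
      unfolding S_def by (simp add: not_le)
  qed
qed

lemma firing_headings_converge:
  obtains L where "\<And>e. 0 < e \<Longrightarrow> \<exists>n0. \<forall>n\<ge>n0. \<forall>i<N. L - e \<le> fire_heading i n \<and> fire_heading i n \<le> L + e"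
proof -
  obtain L where low: "\<And>e. 0 < e \<Longrightarrow> \<exists>n0. \<forall>n\<ge>n0. \<forall>i<N. L - e \<le> fire_heading i n"
    and often: "\<And>e m. 0 < e \<Longrightarrow> \<exists>n\<ge>m. \<exists>i<N. fire_heading i n < L + e"
    using firing_headings_liminf by blast
  obtain C where C: "0 < C" "C \<le> 1" and push:
    "\<And>n m i j. regular n \<Longrightarrow> (\<And>i j. i < N \<Longrightarrow> j < N \<Longrightarrow> m \<le> q i (fire_time j n)) \<Longrightarrow>
      i < N \<Longrightarrow> j < N \<Longrightarrow> C * (fire_heading j n - m) \<le> fire_heading i n - m"
    using firing_push_uniform by blast
  have "\<exists>n0. \<forall>n\<ge>n0. \<forall>i<N. L - e \<le> fire_heading i n \<and> fire_heading i n \<le> L + e" if "0 < e" for e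
  proof -
    \<comment> \<open>The spread \<open>u - l\<close> in \<open>no_return\<close> will be at most
      \<open>2 * d\<close>; the second bound makes it meet the smallness condition there.\<close>
    define d where "d = min e (\<omega>max * pi / (4 * (\<omega>0 + \<omega>max)))"
    have d: "0 < d" "d \<le> e" using \<open>0 < e\<close> \<omega>0_pos \<omega>max_pos by (auto simp: d_def)
    have "d \<le> \<omega>max * pi / (4 * (\<omega>0 + \<omega>max))" by (simp add: d_def)
    then have "4 * (d * (\<omega>0 + \<omega>max)) \<le> \<omega>max * pi"
      using \<omega>0_pos \<omega>max_pos by (simp add: field_simps)
    moreover have "0 < d * (\<omega>0 + \<omega>max)" using d \<omega>0_pos \<omega>max_pos by simp
    ultimately have d_small: "2 * d * (\<omega>0 + \<omega>max) < \<omega>max * pi" by linarith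
    \<comment> \<open>With \<open>C * d = 3 * x\<close>, an excess \<open>d\<close> of one firing
      heading over \<open>l = L - x\<close> lifts all of them to \<open>L + 2 * x\<close>, strictly
      above the level \<open>L + x\<close> that is undercut infinitely often.\<close>
    define x where "x = C * d / 3"
    have "C * d \<le> 1 * d" using C d by (intro mult_right_mono) auto
    then have x: "0 < x" "x \<le> d" using C d by (auto simp: x_def)
    define l where "l = L - x"
    obtain n0 where n0: "\<And>n i. n0 \<le> n \<Longrightarrow> i < N \<Longrightarrow> l \<le> fire_heading i n"
      using low[OF x(1)] unfolding l_def by blast
    obtain r where r: "\<And>n. r \<le> n \<Longrightarrow> regular n" using firing_times_unbounded by blast
    obtain T where T: "0 \<le> T" "\<And>i t. i < N \<Longrightarrow> T \<le> t \<Longrightarrow> l \<le> q i t"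
      using q_eventually_between[of "max n0 r" l hi] n0 fire_heading_bounds r by (metis max.bounded_iff)
    obtain n1 where n1: "\<And>n. n1 \<le> n \<Longrightarrow> regular n \<and> (\<forall>i<N. T + pi / \<omega>max \<le> fire_time i n)"
      using firing_times_unbounded by blast
    have late: "regular n" "\<And>i. i < N \<Longrightarrow> T + pi / \<omega>max \<le> fire_time i n" if "n1 \<le> n" for n
      using n1[OF that] by auto
    have l_le: "l \<le> q i (fire_time j n)" if "n1 \<le> n" "i < N" "j < N" for i j n
    proof (rule T(2)[OF that(2)])
      have "0 < pi / \<omega>max" using \<omega>max_pos by simp
      then show "T \<le> fire_time j n" using late(2)[OF that(1,3)] by simp
    qed
    have push': "C * (fire_heading j n - l) \<le> fire_heading i n - l" if "n1 \<le> n" "i < N" "j < N" for i j n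
      using push[OF late(1)] l_le that by blast
    obtain n2 i0 where n2: "max n0 n1 \<le> n2" "i0 < N" "fire_heading i0 n2 < L + x"
      using often[OF x(1)] by blast
    have upper: "\<forall>j<N. fire_heading j n \<le> L + d" if "n2 \<le> n" for n
      using that
    proof (induction n rule: dec_induct)
      case base
      show ?case
      proof (intro allI impI)
        fix j assume "j < N"
        have "C * (fire_heading j n2 - l) \<le> fire_heading i0 n2 - l" using push'[of n2 i0 j] n2 \<open>j < N\<close> by simp
        also have "\<dots> < 2 * x" using n2 by (simp add: l_def)
        also have "\<dots> < C * d" using C d by (simp add: x_def)
        finally have "C * (fire_heading j n2 - l) < C * d" .
        then show "fire_heading j n2 \<le> L + d" using C x by (simp add: l_def)
      qed
    next
      case (step n)
      show ?case
      proof (rule ccontr)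
        assume "\<not> ?thesis"
        then obtain j where j: "j < N" "L + d < fire_heading j (Suc n)" by (auto simp: not_le)
        have n: "n1 \<le> n" using step n2 by simp
        have b: "L + 2 * x \<le> fire_heading i (Suc n)" if "i < N" for i
        proof -
          have "C * d \<le> C * (fire_heading j (Suc n) - l)"
            using j x C by (intro mult_left_mono) (auto simp: l_def)
          then show ?thesis using push'[of "Suc n" i j] that j n by (simp add: l_def x_def)
        qed
        have "(L + d - l) * (\<omega>0 + \<omega>max) \<le> 2 * d * (\<omega>0 + \<omega>max)"
          using x \<omega>0_pos \<omega>max_pos by (intro mult_right_mono) (auto simp: l_def)
        with d_small have small: "(L + d - l) * (\<omega>0 + \<omega>max) < \<omega>max * pi" by simp
        \<comment> \<open>By \<open>no_return\<close> the headings stay above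
          \<open>L + 2 * x\<close> after their firings in round \<open>n + 1\<close>, which a later
          firing below \<open>L + x\<close> contradicts.\<close>
        obtain m i where m: "Suc n \<le> m" "i < N" "fire_heading i m < L + x" using often[OF x(1)] by blast
        have "fire_time i (Suc n) \<le> fire_time i m" using fire_time_mono[OF m(2) late(1) m(1)] n by simp
        then have "L + 2 * x \<le> q i (fire_time i m)"
          using no_return[OF T(2,1) late[OF n] _ b small m(2)] step.IH by blast
        then show False using m(3) x by (simp add: fire_heading_def)
      qed
    qed
    have "L - e \<le> fire_heading i n \<and> fire_heading i n \<le> L + e" if "n2 \<le> n" "i < N" for i n
      using upper[OF that(1)] n0[of n i] that n2 d x by (auto simp: l_def intro: order_trans)
    then show ?thesis by blast
  qed
  then show thesis using that by blast
qed

lemma headings_converge: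
  obtains L where "\<And>e. 0 < e \<Longrightarrow> \<exists>T\<ge>0. \<forall>t\<ge>T. \<forall>i<N. L - e \<le> q i t \<and> q i t \<le> L + e"
proof -
  obtain L where "\<And>e. 0 < e \<Longrightarrow> \<exists>n0. \<forall>n\<ge>n0. \<forall>i<N. L - e \<le> fire_heading i n \<and> fire_heading i n \<le> L + e"
    using firing_headings_converge by blast
  then have "\<exists>T\<ge>0. \<forall>t\<ge>T. \<forall>i<N. L - e \<le> q i t \<and> q i t \<le> L + e" if "0 < e" for e
    using q_eventually_between[of _ "L - e" "L + e"] that by metis
  then show thesis using that by blast
qed

end

section \<open>Transfer between the real line and the circle\<close>

theorem theorem1:
  fixes N :: nat and E :: "nat \<Rightarrow> nat \<Rightarrow> bool"
    and \<omega>0 \<omega>max \<alpha> D \<Lambda>bar :: real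
    and \<theta>0 :: "nat \<Rightarrow> real"
    and p w :: "nat \<Rightarrow> real \<Rightarrow> real"
  assumes "0 < N"
    and "strongly_connected N E"
    and "\<omega>0 > 0" and "\<omega>max > 0"
    and "0 < \<alpha>" and "\<alpha> \<le> 1"
    and "0 \<le> D" and "D < 2 * pi"
    and "0 < \<Lambda>bar" and "\<Lambda>bar \<le> pi"
    and "D \<le> 2 * pi - \<Lambda>bar"
    and "\<forall>i<N. 0 \<le> \<theta>0 i \<and> \<theta>0 i < 2 * pi"
    and "arc_len N \<theta>0 < \<Lambda>bar"
    and "execution N E \<omega>0 \<omega>max \<alpha> D \<theta>0 p w"
  shows "((\<lambda>t. arc_len N (\<lambda>i. heading \<omega>0 p i t)) \<longlongrightarrow> 0) at_top \<and>
         (\<forall>i<N. \<forall>t\<ge>0. \<forall>d. ((\<lambda>s. p i s - \<omega>0 * s) has_real_derivative d) (at_right t)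
                \<longrightarrow> \<bar>d\<bar> \<le> \<omega>max)"
proof (intro conjI)
  \<comment> \<open>Full turns are added so that the initial headings lie in one interval of length
    \<open>arc_len N \<theta>0\<close>, which is below \<open>pi\<close>.\<close>
  obtain a z where z: "\<And>i. i < N \<Longrightarrow> a \<le> \<theta>0 i + 2 * pi * of_int (z i :: int) \<and>
      \<theta>0 i + 2 * pi * of_int (z i) \<le> a + arc_len N \<theta>0"
    using arc_len_unwrap[of N \<theta>0] assms by blast
  let ?\<theta> = "\<lambda>i. \<theta>0 i + 2 * pi * of_int (z i)" and ?p = "\<lambda>i t. p i t + 2 * pi * of_int (z i)"
  have exec: "execution N E \<omega>0 \<omega>max \<alpha> D ?\<theta> ?p w" using assms by (intro execution_shift)
  interpret pulse_coupled N E \<omega>0 \<omega>max \<alpha> D ?\<theta> ?p w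
    by unfold_locales (use assms exec in auto)
  have p0: "p i 0 = \<theta>0 i" if "i < N" for i
    using assms(14) that by (simp add: execution_def)
  interpret pulse_coupled_arc N E \<omega>0 \<omega>max \<alpha> D ?\<theta> ?p w a "a + arc_len N \<theta>0"
    by unfold_locales (use assms z p0 in auto)
  show "((\<lambda>t. arc_len N (\<lambda>i. heading \<omega>0 p i t)) \<longlongrightarrow> 0) at_top"
  proof -
    have heading: "heading \<omega>0 p i t = wrap (q i t)" for i t
    proof -
      have "q i t = (p i t - \<omega>0 * t) + 2 * pi * of_int (z i)" by (simp add: q_def)
      then show ?thesis by (simp only: heading_def wrap_shift)
    qed
    obtain L where L: "\<And>e. 0 < e \<Longrightarrow> \<exists>T\<ge>0. \<forall>t\<ge>T. \<forall>i<N. L - e \<le> q i t \<and> q i t \<le> L + e"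
      using headings_converge by blast
    have nonneg: "0 \<le> arc_len N (\<lambda>i. heading \<omega>0 p i t)" for t
      by (rule arc_len_nonneg[OF assms(1)]) (simp add: heading_def wrap_bounds)
    show ?thesis
    proof (rule tendstoI)
      fix e :: real assume "0 < e"
      \<comment> \<open>The strip of width \<open>2 * d\<close> must be narrower than
        \<open>e\<close>, and than a full turn for \<open>arc_len_wrap_le\<close>.\<close>
      define d where "d = min e pi / 3"
      have d: "0 < d" "2 * d < e" "2 * d < 2 * pi" using \<open>0 < e\<close> pi_gt_zero by (auto simp: d_def min_def)
      obtain T where T: "\<And>t i. T \<le> t \<Longrightarrow> i < N \<Longrightarrow> L - d \<le> q i t \<and> q i t \<le> L + d"
        using L[OF d(1)] by blast
      have "dist (arc_len N (\<lambda>i. heading \<omega>0 p i t)) 0 < e" if "T \<le> t" for t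
      proof -
        have "L - d \<le> q i t \<and> q i t \<le> L - d + 2 * d" if "i < N" for i
          using T[OF \<open>T \<le> t\<close> that] by simp
        then have "arc_len N (\<lambda>i. wrap (q i t)) \<le> 2 * d"
          by (rule arc_len_wrap_le[OF assms(1) _ d(3)])
        then show ?thesis using nonneg[of t] d by (simp add: heading)
      qed
      then show "\<forall>\<^sub>F t in at_top. dist (arc_len N (\<lambda>i. heading \<omega>0 p i t)) 0 < e"
        unfolding eventually_at_top_linorder by blast
    qed
  qed
  show "\<forall>i<N. \<forall>t\<ge>0. \<forall>d. ((\<lambda>s. p i s - \<omega>0 * s) has_real_derivative d) (at_right t)
      \<longrightarrow> \<bar>d\<bar> \<le> \<omega>max"
  proof (intro allI impI)
    fix i t d assume i: "i < N" and t: "0 \<le> t"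
      and d: "((\<lambda>s. p i s - \<omega>0 * s) has_real_derivative d) (at_right t)"
    have "q i = (\<lambda>s. p i s - \<omega>0 * s + 2 * pi * of_int (z i))"
      by (intro ext) (simp add: q_def)
    then have "(q i has_real_derivative d) (at_right t)"
      using DERIV_add[OF d DERIV_const[of "2 * pi * of_int (z i)"]] by simp
    then have "d = w i t - \<omega>0" using q_deriv[OF i t] by (rule right_derivative_unique)
    then show "\<bar>d\<bar> \<le> \<omega>max" using rate_bound[OF i t] by simp
  qed
qed

end
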